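(* The following hold: (i) For every $1\le p<2$ and each $k\in\mathbb{N}$, there exists a domain $\Omega_k\subset\mathbb{C}$ such that $\dim A^p(\Omega_k)=k$. (ii) For every $2\le p<\infty$ and every domain $\Omega\subset\mathbb{C}$, $A^p(\Omega)$ is either trivial or it is an infinite-dimensional Banach space.
   Context: A domain is an open connected set. For $1\le p<\infty$, $A^p(\Omega)$ is the (complex vector) space of holomorphic functions $f$ on $\Omega$ with $\int_\Omega|f|^p\,d\lambda<\infty$, where $\lambda$ is Lebesgue measure. Trivial means equal to $\{0\}$. $\mathbb{N}=\{1,2,3,\dots\}$. *)

theory Defs
  imports "HOL-Complex_Analysis.Complex_Analysis" "HOL-Library.Function_Algebras"
begin

definition cfun_scale :: "complex \<Rightarrow> (complex \<Rightarrow> complex) \<Rightarrow> complex \<Rightarrow> complex" where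
  "cfun_scale c f = (\<lambda>z. c * f z)"

text \<open>Complex vector space structure on functions; addition is the pointwise one of
  \<^theory>\<open>HOL-Library.Function_Algebras\<close>. Thus \<open>cfun.dim\<close> is the dimension over the complex
  numbers. By the library convention it is \<open>0\<close> for infinite-dimensional spaces, so
  \<open>cfun.dim V = k\<close> with \<open>k \<ge> 1\<close> entails finite-dimensionality.\<close>

global_interpretation cfun: vector_space cfun_scale
  by unfold_locales (auto simp: cfun_scale_def fun_eq_iff algebra_simps)

definition infinite_dimensional :: "(complex \<Rightarrow> complex) set \<Rightarrow> bool" where
  "infinite_dimensional V \<longleftrightarrow> \<not> (\<exists>B. finite B \<and> B \<subseteq> V \<and> cfun.span B = V)"

definition complex_domain :: "complex set \<Rightarrow> bool" where
  "complex_domain \<Omega> \<longleftrightarrow> open \<Omega> \<and> connected \<Omega>"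

text \<open>A function on \<open>\<Omega>\<close> is represented by its extension by \<open>0\<close> to the whole plane, so that
  elements of \<open>A\<^sup>p(\<Omega>)\<close> are equal iff they agree on \<open>\<Omega>\<close>.\<close>

definition Ap :: "real \<Rightarrow> complex set \<Rightarrow> (complex \<Rightarrow> complex) set" where
  "Ap p \<Omega> = {f. f holomorphic_on \<Omega> \<and> (\<forall>z. z \<notin> \<Omega> \<longrightarrow> f z = 0) \<and>
               set_integrable lebesgue \<Omega> (\<lambda>z. norm (f z) powr p)}"

definition Ap_norm :: "real \<Rightarrow> complex set \<Rightarrow> (complex \<Rightarrow> complex) \<Rightarrow> real" where
  "Ap_norm p \<Omega> f = (LINT z:\<Omega>|lebesgue. norm (f z) powr p) powr (1 / p)"

definition complex_normed_space_on ::
    "(complex \<Rightarrow> complex) set \<Rightarrow> ((complex \<Rightarrow> complex) \<Rightarrow> real) \<Rightarrow> bool" where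
  "complex_normed_space_on V N \<longleftrightarrow> cfun.subspace V \<and>
     (\<forall>f\<in>V. 0 \<le> N f \<and> (N f = 0 \<longleftrightarrow> f = 0)) \<and>
     (\<forall>c. \<forall>f\<in>V. N (cfun_scale c f) = norm c * N f) \<and>
     (\<forall>f\<in>V. \<forall>g\<in>V. N (f + g) \<le> N f + N g)"

text \<open>The conjunct \<^const>\<open>Metric_space\<close> ensures that \<^const>\<open>Metric_space.mcomplete\<close> has its
  intended meaning. That locale also asks for nonnegativity and symmetry of the distance outside
  the carrier; \<open>Ap_norm\<close> has these properties on all functions.\<close>

definition complex_banach_space_on ::
    "(complex \<Rightarrow> complex) set \<Rightarrow> ((complex \<Rightarrow> complex) \<Rightarrow> real) \<Rightarrow> bool" where
  "complex_banach_space_on V N \<longleftrightarrow> complex_normed_space_on V N \<and>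
     Metric_space V (\<lambda>f g. N (f - g)) \<and> Metric_space.mcomplete V (\<lambda>f g. N (f - g))"

end

theory Submission
  imports Defs
begin

text \<open>
  Both parts rest on one estimate: a holomorphic function \<open>f\<close> on the ball \<open>B(a, R)\<close> satisfies
  \<open>R\<^sup>2 \<bar>f(a)\<bar>\<^sup>p \<le> C \<integral> \<bar>f\<bar>\<^sup>p\<close> (\<open>powr_norm_le_area_integral\<close>). Because the \<open>p\<close>-mass of shrinking or
  escaping balls tends to \<open>0\<close>, an \<open>L\<^sup>p\<close> function satisfies \<open>\<bar>z - a\<bar>\<^sup>2 \<bar>f(z)\<bar>\<^sup>p \<rightarrow> 0\<close> at an isolated
  singularity \<open>a\<close>, and \<open>\<bar>z\<bar>\<^sup>2 \<bar>f(z)\<bar>\<^sup>p \<rightarrow> 0\<close> at infinity (\<open>puncture_decay\<close>, \<open>infinity_decay\<close>). It also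
  makes point evaluations bounded, which gives completeness of the space (\<open>Ap_banach\<close>).

  Let \<open>1 \<le> p < 2\<close>, let \<open>m\<close> be the largest integer with \<open>m p \<le> 2\<close>, and remove \<open>k + m\<close> points from the
  plane. Let \<open>Q\<close> be the polynomial with these points as simple zeros. Members of the space
  have at most simple poles at the punctures and are \<open>o(z\<^sup>-\<^sup>m)\<close> at infinity, so \<open>f Q\<close> is a polynomial
  of degree less than \<open>k\<close>. Conversely every quotient \<open>P / Q\<close> with \<open>P\<close> of degree less than \<open>k\<close> is in the
  space, whose dimension is therefore \<open>k\<close> (\<open>dim_Ap_punctured_plane\<close>).

  Let \<open>p \<ge> 2\<close> and let \<open>f \<noteq> 0\<close> be in the space. If \<open>\<Omega>\<close> carries a bounded nonconstant holomorphic
  function \<open>g\<close>, the products \<open>g\<^sup>i f\<close> span an infinite-dimensional space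
  (\<open>bounded_nonconstant_imp_infinite_dimensional\<close>). Such a \<open>g\<close> exists unless the complement of \<open>\<Omega>\<close>
  is a null set: \<open>1 / (z - b)\<close> if \<open>b\<close> is interior to the complement, and otherwise the Cauchy transform of
  a compact subset of the complement of positive measure. If the complement is null and the space is
  finite-dimensional, consider for varying \<open>b\<close> and fixed \<open>c\<close> the functions
  \<open>f(c) (f(z) - f(b)) / (z - b) - f(b) (f(z) - f(c)) / (z - c)\<close>. They lie in the space because the
  terms of order \<open>1 / z\<close> at infinity cancel, and a linear relation between finitely many of them shows
  that \<open>f\<close> is a rational function. As the complement is null, \<open>f\<close> is in \<open>L\<^sup>p\<close> of a finitely punctured
  plane; for \<open>p \<ge> 2\<close> the punctures are removable and Liouville's theorem gives \<open>f = 0\<close>, a contradiction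
  (\<open>null_complement_imp_infinite_dimensional\<close>).
\<close>

section \<open>Convexity of powers\<close>

lemma powr_above_tangent:
  fixes p x t :: real
  assumes p: "1 \<le> p" and x: "0 \<le> x" and t: "0 \<le> t"
  shows "t powr p + p * t powr (p - 1) * (x - t) \<le> x powr p"
proof (cases "t = 0")
  case False
  with t have t0: "t > 0" by simp
  have tp: "t powr p = t powr (p - 1) * t"
    using t0 by (simp add: powr_diff)
  show ?thesis
  proof (cases "x = 0")
    case True
    have "t powr (p - 1) * t * (1 - p) \<le> 0"
      using p t by (intro mult_nonneg_nonpos) auto
    then show ?thesis using True by (simp add: tp algebra_simps)
  next
    case False
    with x have x0: "x > 0" by simp
    have "x powr p - t powr p \<ge> (p * t powr (p - 1)) * (x - t)"
    proof (rule convex_on_imp_above_tangent[where A = "{0<..}"])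
      show "convex_on {0<..} (\<lambda>x. x powr p)" using p by (rule powr_convex)
      show "((\<lambda>x. x powr p) has_real_derivative p * t powr (p - 1)) (at t within {0<..})"
        using t0 by (auto intro!: derivative_eq_intros simp: powr_diff field_simps)
    qed (use t0 x0 in \<open>auto simp: interior_open\<close>)
    then show ?thesis by simp
  qed
qed (use assms in auto)

lemma powr_convex_combination:
  fixes p x y u v :: real
  assumes "1 \<le> p" "0 \<le> x" "0 \<le> y" "0 \<le> u" "0 \<le> v" "u + v = 1"
  shows "(u * x + v * y) powr p \<le> u * x powr p + v * y powr p"
proof -
  define t where "t = u * x + v * y"
  have t: "t \<ge> 0" using assms by (simp add: t_def)
  have "u * (t powr p + p * t powr (p - 1) * (x - t)) + v * (t powr p + p * t powr (p - 1) * (y - t))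
        \<le> u * x powr p + v * y powr p"
    using powr_above_tangent[OF assms(1,2) t] powr_above_tangent[OF assms(1,3) t] assms
    by (intro add_mono mult_left_mono) auto
  moreover have "u * (t powr p + p * t powr (p - 1) * (x - t)) + v * (t powr p + p * t powr (p - 1) * (y - t))
     = (u + v) * t powr p + p * t powr (p - 1) * (u * x + v * y - (u + v) * t)"
    by (simp add: algebra_simps)
  ultimately show ?thesis using assms(6) by (simp add: t_def)
qed

lemma powr_add_le:
  fixes x y p :: real
  assumes "1 \<le> p" "0 \<le> x" "0 \<le> y"
  shows "(x + y) powr p \<le> 2 powr p * (x powr p + y powr p)"
proof -
  have "(x + y) powr p = (2 * (1/2 * x + 1/2 * y)) powr p" by simp
  also have "\<dots> = 2 powr p * (1/2 * x + 1/2 * y) powr p" by (rule powr_mult)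
  also have "\<dots> \<le> 2 powr p * (1/2 * x powr p + 1/2 * y powr p)"
    using assms by (intro mult_left_mono powr_convex_combination) auto
  also have "\<dots> \<le> 2 powr p * (x powr p + y powr p)"
    by (intro mult_left_mono add_mono) auto
  finally show ?thesis .
qed

section \<open>Bergman functions and Borel measurability\<close>

lemma holomorphic_extension_borel_measurable:
  assumes "open \<Omega>" "f holomorphic_on \<Omega>" "\<And>z. z \<notin> \<Omega> \<Longrightarrow> f z = 0"
  shows "f \<in> borel_measurable borel"
proof -
  have "(\<lambda>z. indicator \<Omega> z *\<^sub>R f z) \<in> borel_measurable borel"
    using assms by (intro borel_measurable_continuous_on_indicator holomorphic_on_imp_continuous_on) auto
  moreover have "(\<lambda>z. indicator \<Omega> z *\<^sub>R f z) = f"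
    using assms(3) by (auto simp: indicator_def fun_eq_iff)
  ultimately show ?thesis by simp
qed

text \<open>Since \<open>0 powr p = 0\<close>, the function \<open>\<bar>f\<bar>\<^sup>p\<close> vanishes off \<open>\<Omega>\<close>, and it is Borel measurable. Hence the
  integral over \<open>\<Omega>\<close> against the completed measure is the integral over the whole plane against
  \<^const>\<open>lborel\<close>.\<close>

lemma Ap_iff:
  assumes "open \<Omega>"
  shows "f \<in> Ap p \<Omega> \<longleftrightarrow> f holomorphic_on \<Omega> \<and> (\<forall>z. z \<notin> \<Omega> \<longrightarrow> f z = 0) \<and>
           integrable lborel (\<lambda>z. norm (f z) powr p)"
proof -
  have "set_integrable lebesgue \<Omega> (\<lambda>z. norm (f z) powr p) \<longleftrightarrow> integrable lborel (\<lambda>z. norm (f z) powr p)"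
    if h: "f holomorphic_on \<Omega>" and z: "\<And>z. z \<notin> \<Omega> \<Longrightarrow> f z = 0"
  proof -
    have "f \<in> borel_measurable borel"
      using assms h z by (rule holomorphic_extension_borel_measurable)
    then have "(\<lambda>z. norm (f z) powr p) \<in> borel_measurable lborel" by measurable
    moreover have "(\<lambda>z. indicat_real \<Omega> z *\<^sub>R norm (f z) powr p) = (\<lambda>z. norm (f z) powr p)"
      using z by (auto simp: indicator_def fun_eq_iff)
    ultimately show ?thesis
      unfolding set_integrable_def by (simp add: integrable_completion)
  qed
  then show ?thesis unfolding Ap_def by blast
qed

lemma Ap_norm_eq:
  assumes "open \<Omega>" "f \<in> Ap p \<Omega>"
  shows "Ap_norm p \<Omega> f = (LINT z|lborel. norm (f z) powr p) powr (1 / p)"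
proof -
  have z: "\<And>z. z \<notin> \<Omega> \<Longrightarrow> f z = 0" and h: "f holomorphic_on \<Omega>"
    using assms by (auto simp: Ap_iff)
  have "f \<in> borel_measurable borel"
    using assms(1) h z by (rule holomorphic_extension_borel_measurable)
  then have m: "(\<lambda>z. norm (f z) powr p) \<in> borel_measurable lborel" by measurable
  have "(\<lambda>z. indicat_real \<Omega> z *\<^sub>R norm (f z) powr p) = (\<lambda>z. norm (f z) powr p)"
    using z by (auto simp: indicator_def fun_eq_iff)
  then show ?thesis
    unfolding Ap_norm_def set_lebesgue_integral_def using m by (simp add: integral_completion)
qed

section \<open>An area mean value inequality\<close>

text \<open>Cauchy's formula for \<open>f a\<close> on a circle whose centre \<open>c\<close> is within \<open>r / 2\<close> of \<open>a\<close>: the kernel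
  \<open>r / \<bar>u - a\<bar>\<close> is at most \<open>2\<close> there.\<close>

lemma norm_le_integral_circle:
  fixes f :: "complex \<Rightarrow> complex"
  assumes f: "f holomorphic_on ball a (2 * r)" and r: "r > 0" and c: "dist a c < r / 2"
  shows "ennreal (norm (f a)) \<le>
     2 * (\<integral>\<^sup>+x. indicator {0..1} x * norm (f (circlepath c r x)) \<partial>lborel)"
proof -
  let ?g = "circlepath c r"
  have sub: "cball c r \<subseteq> ball a (2 * r)"
  proof
    fix z assume "z \<in> cball c r"
    then show "z \<in> ball a (2 * r)"
      using c r dist_triangle[of a z c] by auto
  qed
  have contf: "continuous_on (cball c r) f"
    using f sub holomorphic_on_imp_continuous_on holomorphic_on_subset by blast
  have g_on: "?g x \<in> sphere c r" if "x \<in> {0..1}" for x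
    using r that by (auto simp: path_image_def)
      (metis abs_of_pos imageI path_image_circlepath path_image_def r atLeastAtMost_iff mem_sphere)
  have contg: "continuous_on {0..1} ?g"
    using path_circlepath[of c r] by (simp add: path_def)
  have contfg: "continuous_on {0..1} (\<lambda>x. norm (f (?g x)))"
    using g_on by (intro continuous_intros continuous_on_compose2[OF contf contg]) auto
  have "((\<lambda>u. f u / (u - a)) has_contour_integral (2 * of_real pi * \<i> * f a)) ?g"
    using c r by (intro Cauchy_integral_circlepath contf holomorphic_on_subset[OF f])
       (use sub in \<open>auto simp: dist_norm norm_minus_commute\<close>)
  then have *: "((\<lambda>x. f (?g x) / (?g x - a) * vector_derivative ?g (at x within {0..1}))
      has_integral (2 * of_real pi * \<i> * f a)) {0..1}"
    by (simp add: has_contour_integral_def)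
  have bd: "norm (f (?g x) / (?g x - a) * vector_derivative ?g (at x within {0..1}))
     \<le> 4 * pi * norm (f (?g x))" if x: "x \<in> {0..1}" for x
  proof -
    have "dist c (?g x) = r" using g_on[OF x] by simp
    then have d: "norm (?g x - a) \<ge> r / 2"
      using c dist_triangle[of c "?g x" a] by (simp add: dist_norm norm_minus_commute)
    have v: "norm (vector_derivative ?g (at x within {0..1})) = 2 * pi * r"
      using x r by (simp add: vector_derivative_circlepath01 norm_mult)
    have "norm (f (?g x)) / norm (?g x - a) \<le> norm (f (?g x)) / (r / 2)"
      using d r by (intro divide_left_mono mult_pos_pos) auto
    then have "norm (f (?g x)) / norm (?g x - a) * (2 * pi * r) \<le> norm (f (?g x)) / (r / 2) * (2 * pi * r)"
      using r by (intro mult_right_mono) auto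
    also have "\<dots> = 4 * pi * norm (f (?g x))" using r by (simp add: field_simps)
    finally show ?thesis by (simp add: norm_mult norm_divide v)
  qed
  have int: "(\<lambda>x. norm (f (?g x))) integrable_on {0..1}"
    using contfg by (rule integrable_continuous_interval)
  have "norm (2 * of_real pi * \<i> * f a) \<le> integral {0..1} (\<lambda>x. 4 * pi * norm (f (?g x)))"
    unfolding integral_unique[OF *, symmetric]
    by (rule integral_norm_bound_integral)
       (use * int bd in \<open>auto intro!: integrable_on_cmult_left has_integral_integrable\<close>)
  then have le: "norm (f a) \<le> 2 * integral {0..1} (\<lambda>x. norm (f (?g x)))"
    by (simp add: norm_mult)
  have si: "set_integrable lborel {0..1} (\<lambda>x. norm (f (?g x)))"
    unfolding set_integrable_def using contfg by (intro borel_integrable_compact) auto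
  have "ennreal (integral {0..1} (\<lambda>x. norm (f (?g x)))) = ennreal (LINT x:{0..1}|lborel. norm (f (?g x)))"
    using set_borel_integral_eq_integral(2)[OF si] by simp
  also have "\<dots> = (\<integral>\<^sup>+x. indicator {0..1} x * norm (f (?g x)) \<partial>lborel)"
    unfolding set_lebesgue_integral_def
    using si by (subst nn_integral_eq_integral[symmetric])
      (auto simp: set_integrable_def intro!: nn_integral_cong split: split_indicator)
  finally have e: "ennreal (integral {0..1} (\<lambda>x. norm (f (?g x)))) = (\<integral>\<^sup>+x. indicator {0..1} x * norm (f (?g x)) \<partial>lborel)" .
  have "ennreal (norm (f a)) \<le> ennreal (2 * integral {0..1} (\<lambda>x. norm (f (?g x))))"
    using le by (rule ennreal_leI)
  then show ?thesis by (simp add: ennreal_mult' e)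
qed

text \<open>The circle estimate is averaged over the centre \<open>c\<close> in the small ball. Exchanging the two
  integrations leaves, for each point of the circle, an integral over translates of \<open>\<bar>f\<bar>\<close>, so that
  only the translation invariance of Lebesgue measure is needed.\<close>

lemma norm_le_area_integral:
  fixes f :: "complex \<Rightarrow> complex"
  assumes f: "f holomorphic_on ball a (2 * r)" and r: "r > 0"
  shows "ennreal (norm (f a)) * emeasure lborel (ball a (r / 2)) \<le>
           2 * (\<integral>\<^sup>+w. indicator (ball a (2 * r)) w * norm (f w) \<partial>lborel)"
proof -
  define F where "F = (\<lambda>w. indicator (ball a (2 * r)) w *\<^sub>R norm (f w))"
  have F0: "F w \<ge> 0" for w by (simp add: F_def)
  have [measurable]: "F \<in> borel_measurable borel"
    unfolding F_def using holomorphic_on_imp_continuous_on[OF f]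
    by (intro borel_measurable_continuous_on_indicator continuous_intros) auto
  define e where "e = (\<lambda>x. r * exp (2 * of_real pi * \<i> * complex_of_real x))"
  have [measurable]: "e \<in> borel_measurable borel"
    unfolding e_def by (intro borel_measurable_continuous_onI continuous_intros)
  have [measurable]: "ball a (r / 2) \<in> sets borel" by simp
  have "ennreal (norm (f a)) * emeasure lborel (ball a (r / 2))
      = (\<integral>\<^sup>+c. ennreal (norm (f a)) * indicator (ball a (r / 2)) c \<partial>lborel)"
    by (simp add: nn_integral_cmult_indicator)
  also have "\<dots> \<le> (\<integral>\<^sup>+c. (\<integral>\<^sup>+x. 2 * indicator {0..1::real} x * ennreal (F (c + e x)) \<partial>lborel) \<partial>lborel)"
  proof (rule nn_integral_mono)
    fix c
    show "ennreal (norm (f a)) * indicator (ball a (r / 2)) c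
      \<le> (\<integral>\<^sup>+x. 2 * indicator {0..1::real} x * ennreal (F (c + e x)) \<partial>lborel)"
    proof (cases "c \<in> ball a (r / 2)")
      case True
      then have c: "dist a c < r / 2" by simp
      have "c + e x \<in> ball a (2 * r)" for x
      proof -
        have "dist c (c + e x) = r" using r by (simp add: dist_norm e_def norm_mult)
        then show ?thesis using c r dist_triangle[of a "c + e x" c] by (auto simp: dist_commute)
      qed
      then have "ennreal (norm (f (circlepath c r x))) = ennreal (F (c + e x))" for x
        by (simp add: F_def circlepath e_def)
      then have "(\<integral>\<^sup>+x. ennreal (indicator {0..1} x * norm (f (circlepath c r x))) \<partial>lborel)
          = (\<integral>\<^sup>+x. indicator {0..1::real} x * ennreal (F (c + e x)) \<partial>lborel)"
        by (intro nn_integral_cong) (auto split: split_indicator)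
      then have "ennreal (norm (f a)) \<le> 2 * (\<integral>\<^sup>+x. indicator {0..1::real} x * ennreal (F (c + e x)) \<partial>lborel)"
        using norm_le_integral_circle[OF f r c] by simp
      then show ?thesis using True
        by (simp add: nn_integral_cmult[symmetric] mult.assoc)
    qed simp
  qed
  also have "\<dots> = (\<integral>\<^sup>+x. (\<integral>\<^sup>+c. 2 * indicator {0..1::real} x * ennreal (F (c + e x)) \<partial>lborel) \<partial>lborel)"
    by (rule lborel_pair.Fubini') measurable
  also have "\<dots> = (\<integral>\<^sup>+x. 2 * indicator {0..1::real} x * (\<integral>\<^sup>+w. F w \<partial>lborel) \<partial>lborel)"
  proof (intro nn_integral_cong)
    fix x :: real
    have "(\<integral>\<^sup>+w. F w \<partial>lborel) = (\<integral>\<^sup>+w. F w \<partial>(distr lborel borel ((+) (e x))))"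
      by (simp only: lborel_distr_plus)
    also have "\<dots> = (\<integral>\<^sup>+c. F (e x + c) \<partial>lborel)"
      by (subst nn_integral_distr) auto
    finally show "(\<integral>\<^sup>+c. 2 * indicator {0..1::real} x * ennreal (F (c + e x)) \<partial>lborel) =
       2 * indicator {0..1::real} x * (\<integral>\<^sup>+w. F w \<partial>lborel)"
      by (simp add: nn_integral_cmult add.commute)
  qed
  also have "\<dots> = 2 * (\<integral>\<^sup>+w. F w \<partial>lborel)"
    by (simp add: nn_integral_multc nn_integral_cmult)
  also have "(\<integral>\<^sup>+w. F w \<partial>lborel) = (\<integral>\<^sup>+w. indicator (ball a (2 * r)) w * norm (f w) \<partial>lborel)"
    by (intro nn_integral_cong) (auto simp: F_def split: split_indicator)
  finally show ?thesis .
qed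

text \<open>The passage from exponent \<open>1\<close> to \<open>p\<close> replaces Hoelder's inequality by the tangent to \<open>x\<^sup>p\<close> at
  \<open>t = \<bar>f a\<bar> / 32\<close>: the mean of \<open>\<bar>f\<bar>\<close> over the ball is at least \<open>t\<close>, so integrating the linear term
  contributes a nonnegative amount.\<close>

lemma powr_norm_le_area_integral:
  fixes f :: "complex \<Rightarrow> complex"
  assumes p: "1 \<le> p" and f: "f holomorphic_on ball a R" and R: "R > 0"
    and int: "set_integrable lborel (ball a R) (\<lambda>w. norm (f w) powr p)"
  shows "(norm (f a) / 32) powr p * (pi * R\<^sup>2) \<le> (LINT w:ball a R|lborel. norm (f w) powr p)"
proof -
  let ?B = "ball a R"
  define t where "t = norm (f a) / 32"
  have t0: "t \<ge> 0" by (simp add: t_def)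
  have meas: "emeasure lborel (ball a s) = ennreal (pi * s\<^sup>2)" if "s \<ge> 0" for s
    using that by (simp add: emeasure_ball eval_unit_ball_vol)
  have mB: "measure lborel ?B = pi * R\<^sup>2"
    using meas[of R] R by (simp add: measure_def)
  have fin: "emeasure lborel ?B < \<infinity>" using meas[of R] R by simp
  have mf: "set_borel_measurable lborel ?B (\<lambda>w. norm (f w))"
  proof -
    have "(\<lambda>w. indicator ?B w *\<^sub>R norm (f w)) \<in> borel_measurable borel"
      using holomorphic_on_imp_continuous_on[OF f]
      by (intro borel_measurable_continuous_on_indicator continuous_intros) auto
    then show ?thesis unfolding set_borel_measurable_def by simp
  qed
  have c1: "set_integrable lborel ?B (\<lambda>w. c)" for c :: real
    using fin unfolding set_integrable_def by simp
  have i1: "set_integrable lborel ?B (\<lambda>w. norm (f w))"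
  proof (rule set_integrable_bound)
    show "set_integrable lborel ?B (\<lambda>w. norm (f w) powr p + 1)"
      using int c1 by (rule set_integral_add)
    have "x \<le> x powr p + 1" if "x \<ge> 0" for x :: real
    proof (cases "x \<le> 1")
      case True then show ?thesis by (smt (verit) powr_ge_zero)
    next
      case False
      then have "x powr 1 \<le> x powr p" using p by (intro powr_mono) auto
      then show ?thesis using False by simp
    qed
    then show "AE w in lborel. w \<in> ?B \<longrightarrow> norm (norm (f w)) \<le> norm (norm (f w) powr p + 1)"
      by (auto simp: abs_of_nonneg)
  qed (use mf in auto)
  have "ennreal (norm (f a)) * emeasure lborel (ball a (R / 2 / 2)) \<le>
           2 * (\<integral>\<^sup>+w. indicator (ball a (2 * (R / 2))) w * norm (f w) \<partial>lborel)"
    using f R by (intro norm_le_area_integral) auto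
  also have "(\<integral>\<^sup>+w. indicator (ball a (2 * (R / 2))) w * norm (f w) \<partial>lborel) = ennreal (LINT w:?B|lborel. norm (f w))"
    unfolding set_lebesgue_integral_def
    using i1 by (subst nn_integral_eq_integral[symmetric])
      (auto simp: set_integrable_def intro!: nn_integral_cong split: split_indicator)
  finally have "ennreal (norm (f a) * (pi * (R / 4)\<^sup>2)) \<le> ennreal (2 * (LINT w:?B|lborel. norm (f w)))"
    using R by (simp add: meas ennreal_mult' ennreal_mult'')
  moreover have I0: "(LINT w:?B|lborel. norm (f w)) \<ge> 0"
    unfolding set_lebesgue_integral_def by (intro Bochner_Integration.integral_nonneg) auto
  ultimately have "norm (f a) * (pi * (R / 4)\<^sup>2) \<le> 2 * (LINT w:?B|lborel. norm (f w))"
    by (subst (asm) ennreal_le_iff) auto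
  then have I: "t * (pi * R\<^sup>2) \<le> (LINT w:?B|lborel. norm (f w))"
    by (simp add: t_def field_simps power2_eq_square)
  have "t powr p * (pi * R\<^sup>2) \<le> t powr p * (pi * R\<^sup>2) +
      p * t powr (p - 1) * ((LINT w:?B|lborel. norm (f w)) - t * (pi * R\<^sup>2))"
    using I p by auto
  also have "\<dots> = (LINT w:?B|lborel. t powr p + p * t powr (p - 1) * (norm (f w) - t))"
    using c1 i1 fin
    by (simp add: set_integral_add set_integral_diff set_integral_const mB algebra_simps)
  also have "\<dots> \<le> (LINT w:?B|lborel. norm (f w) powr p)"
    using c1 i1 int p t0 by (intro set_integral_mono set_integral_add set_integral_diff set_integrable_mult_right powr_above_tangent) auto
  finally show ?thesis by (simp add: t_def)
qed

section \<open>Decay at punctures and at infinity\<close>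

text \<open>The balls carry vanishing mass by dominated convergence, so the mean value inequality gives
  decay rather than boundedness. This gain decides the borderline exponents \<open>p = 1\<close> and \<open>p = 2\<close>.\<close>

lemma shrinking_ball_decay:
  fixes f :: "complex \<Rightarrow> complex" and z :: "nat \<Rightarrow> complex"
  assumes p: "1 \<le> p" and "open \<Omega>" and f: "f holomorphic_on \<Omega>"
    and int: "set_integrable lborel \<Omega> (\<lambda>w. norm (f w) powr p)"
    and r: "\<And>n. r n > 0" and sub: "\<And>n. ball (z n) (r n) \<subseteq> \<Omega>"
    and ev: "\<And>w. w \<in> \<Omega> \<Longrightarrow> eventually (\<lambda>n. w \<notin> ball (z n) (r n)) sequentially"
  shows "(\<lambda>n. (r n)\<^sup>2 * norm (f (z n)) powr p) \<longlonglongrightarrow> 0"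
proof -
  let ?g = "\<lambda>w. indicator \<Omega> w *\<^sub>R norm (f w) powr p"
  define I where "I = (\<lambda>n. LINT w:ball (z n) (r n)|lborel. norm (f w) powr p)"
  have gint: "integrable lborel ?g" using int by (simp add: set_integrable_def)
  then have gm: "?g \<in> borel_measurable lborel" by auto
  have "indicator (ball (z n) (r n)) w *\<^sub>R norm (f w) powr p = indicator (ball (z n) (r n)) w *\<^sub>R ?g w" for n w
    using subsetD[OF sub[of n], of w] by (cases "w \<in> ball (z n) (r n)") simp_all
  then have "I = (\<lambda>n. LINT w|lborel. indicator (ball (z n) (r n)) w *\<^sub>R ?g w)"
    unfolding I_def set_lebesgue_integral_def by presburger
  also have "\<dots> \<longlonglongrightarrow> (LINT w::complex|lborel. (0::real))"
  proof (rule integral_dominated_convergence[where w = ?g])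
    show "(\<lambda>w. indicator (ball (z n) (r n)) w *\<^sub>R ?g w) \<in> borel_measurable lborel" for n
      by (rule borel_measurable_scaleR[OF borel_measurable_indicator gm]) simp
    show "AE w in lborel. (\<lambda>n. indicator (ball (z n) (r n)) w *\<^sub>R ?g w) \<longlonglongrightarrow> 0"
    proof (rule AE_I2)
      fix w
      show "(\<lambda>n. indicator (ball (z n) (r n)) w *\<^sub>R ?g w) \<longlonglongrightarrow> 0"
      proof (cases "w \<in> \<Omega>")
        case True
        then have "eventually (\<lambda>n. indicator (ball (z n) (r n)) w *\<^sub>R ?g w = 0) sequentially"
          by (rule eventually_mono[OF ev]) auto
        then show ?thesis by (rule tendsto_eventually)
      qed simp
    qed
  qed (use gint in \<open>auto split: split_indicator\<close>)
  finally have I: "I \<longlonglongrightarrow> 0" by simp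
  have le: "(norm (f (z n)) / 32) powr p * (pi * (r n)\<^sup>2) \<le> I n" for n
    unfolding I_def
    using f sub[of n] r[of n]
    by (intro powr_norm_le_area_integral[OF p] set_integrable_subset[OF int]) (auto intro: holomorphic_on_subset)
  have le': "(r n)\<^sup>2 * norm (f (z n)) powr p \<le> (32 powr p / pi) * I n" for n
    using le[of n] by (simp add: powr_divide field_simps)
  show ?thesis
  proof (rule tendsto_sandwich[where f = "\<lambda>_. 0" and h = "\<lambda>n. (32 powr p / pi) * I n"])
    show "(\<lambda>n. (32 powr p / pi) * I n) \<longlonglongrightarrow> 0"
      using tendsto_mult_right_zero[OF I] by simp
  qed (use le' in auto)
qed

lemma puncture_decay:
  fixes f :: "complex \<Rightarrow> complex"
  assumes p: "1 \<le> p" and f: "f holomorphic_on (ball a R - {a})" and R: "R > 0"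
    and int: "set_integrable lborel (ball a R - {a}) (\<lambda>w. norm (f w) powr p)"
  shows "((\<lambda>z. norm (z - a) ^ 2 * norm (f z) powr p) \<longlongrightarrow> 0) (at a)"
  unfolding tendsto_at_iff_sequentially
proof (intro allI impI)
  fix X :: "nat \<Rightarrow> complex"
  assume X: "\<forall>i. X i \<in> UNIV - {a}" "X \<longlonglongrightarrow> a"
  have "eventually (\<lambda>n. dist (X n) a < R / 2) sequentially"
    using X(2) R by (intro tendstoD) auto
  then obtain N where N: "\<And>n. n \<ge> N \<Longrightarrow> dist (X n) a < R / 2"
    by (auto simp: eventually_sequentially)
  define z where "z = (\<lambda>n. X (n + N))"
  have z: "dist (z n) a < R / 2" "z n \<noteq> a" for n
    using N X(1) by (auto simp: z_def)
  have zl: "z \<longlonglongrightarrow> a" unfolding z_def using X(2) by (rule LIMSEQ_ignore_initial_segment)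
  have "(\<lambda>n. (norm (z n - a))\<^sup>2 * norm (f (z n)) powr p) \<longlonglongrightarrow> 0"
  proof (rule shrinking_ball_decay[OF p _ f int])
    show "ball (z n) (norm (z n - a)) \<subseteq> ball a R - {a}" for n
    proof
      fix w assume "w \<in> ball (z n) (norm (z n - a))"
      then have w: "dist (z n) w < dist (z n) a" by (simp add: dist_norm)
      moreover have "dist a w \<le> dist (z n) a + dist (z n) w"
        by (metis dist_commute dist_triangle)
      ultimately show "w \<in> ball a R - {a}" using z[of n] by auto
    qed
    show "eventually (\<lambda>n. w \<notin> ball (z n) (norm (z n - a))) sequentially" if "w \<in> ball a R - {a}" for w
    proof -
      have "eventually (\<lambda>n. dist (z n) a < dist a w / 2) sequentially"
        using zl that by (intro tendstoD) auto
      then show ?thesis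
      proof eventually_elim
        case (elim n)
        have "dist a w \<le> dist (z n) a + dist (z n) w"
          by (metis dist_commute dist_triangle)
        with elim show ?case by (simp add: dist_norm)
      qed
    qed
  qed (use z in auto)
  then have "(\<lambda>n. ((\<lambda>z. norm (z - a) ^ 2 * norm (f z) powr p) \<circ> X) (n + N)) \<longlonglongrightarrow> 0"
    by (simp add: z_def o_def)
  then show "((\<lambda>z. norm (z - a) ^ 2 * norm (f z) powr p) \<circ> X) \<longlonglongrightarrow> 0"
    by (rule LIMSEQ_offset)
qed

lemma infinity_decay:
  fixes f :: "complex \<Rightarrow> complex"
  assumes p: "1 \<le> p" and f: "f holomorphic_on (- cball 0 R)"
    and int: "set_integrable lborel (- cball 0 R) (\<lambda>w. norm (f w) powr p)"
  shows "((\<lambda>z. norm z ^ 2 * norm (f z) powr p) \<longlongrightarrow> 0) at_infinity"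
proof (rule ccontr)
  assume "\<not> ?thesis"
  then obtain e where e: "e > 0"
    and "\<And>b. \<exists>z. norm z \<ge> b \<and> \<not> dist (norm z ^ 2 * norm (f z) powr p) 0 < e"
    unfolding Lim_at_infinity by blast
  then have "\<exists>z. norm z \<ge> 2 * \<bar>R\<bar> + 1 + real n \<and> \<not> norm z ^ 2 * norm (f z) powr p < e" for n
    by (simp add: abs_mult)
  then obtain z where z: "\<And>n::nat. norm (z n) \<ge> 2 * \<bar>R\<bar> + 1 + real n"
      "\<And>n::nat. \<not> norm (z n) ^ 2 * norm (f (z n)) powr p < e"
    by metis
  have "(\<lambda>n. (norm (z n) / 2)\<^sup>2 * norm (f (z n)) powr p) \<longlonglongrightarrow> 0"
  proof (rule shrinking_ball_decay[OF p _ f int])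
    show "norm (z n) / 2 > 0" for n using z(1)[of n] by linarith
    have far: "norm (z n) / 2 < norm w" if "w \<in> ball (z n) (norm (z n) / 2)" for w n
      using that norm_triangle_ineq2[of "z n" w] by (auto simp: dist_norm)
    show "ball (z n) (norm (z n) / 2) \<subseteq> - cball 0 R" for n
      using far[of _ n] z(1)[of n] by fastforce
    show "eventually (\<lambda>n. w \<notin> ball (z n) (norm (z n) / 2)) sequentially" for w
    proof -
      have "eventually (\<lambda>n::nat. real n > 2 * norm w) sequentially"
        using eventually_gt_at_top[of "nat \<lceil>2 * norm w\<rceil>"] by eventually_elim linarith
      then show ?thesis
      proof eventually_elim
        case (elim n)
        then show ?case using far[of w n] z(1)[of n] by linarith
      qed
    qed
  qed auto
  then have "(\<lambda>n. 4 * ((norm (z n) / 2)\<^sup>2 * norm (f (z n)) powr p)) \<longlonglongrightarrow> 4 * 0"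
    by (rule tendsto_mult_left)
  then have "(\<lambda>n. (norm (z n))\<^sup>2 * norm (f (z n)) powr p) \<longlonglongrightarrow> 0"
    by (simp add: power_divide)
  from order_tendstoD(2)[OF this e] show False using z(2) by (auto simp: eventually_sequentially)
qed

section \<open>Integrability of powers of the distance\<close>

lemma two_power_squared: "((2::real) ^ k)\<^sup>2 = 4 ^ k"
proof -
  have "((2::real) ^ k)\<^sup>2 = (2\<^sup>2) ^ k"
    by (metis power_mult mult.commute)
  also have "(2::real)\<^sup>2 = 4" by simp
  finally show ?thesis .
qed

text \<open>Comparison with balls: on \<open>A\<close> the function \<open>g\<close> is at most \<open>\<Sum>k. c k * indicator (ball a (\<rho> k))\<close>.\<close>

lemma set_integrable_by_balls:
  fixes g :: "complex \<Rightarrow> real"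
  assumes [measurable]: "A \<in> sets borel" "g \<in> borel_measurable borel"
    and g0: "\<And>w. g w \<ge> 0" and c: "\<And>k. c k \<ge> 0" and \<rho>: "\<And>k. \<rho> k \<ge> 0"
    and summ: "summable (\<lambda>k. c k * (\<rho> k)\<^sup>2)"
    and bd: "\<And>w. w \<in> A \<Longrightarrow> \<exists>k::nat. norm (w - a) < \<rho> k \<and> g w \<le> c k"
  shows "set_integrable lborel A g"
    and "(LINT w:A|lborel. g w) \<le> pi * (\<Sum>k. c k * (\<rho> k)\<^sup>2)"
proof -
  let ?S = "pi * (\<Sum>k. c k * (\<rho> k)\<^sup>2)"
  have S0: "?S \<ge> 0" using c by (intro mult_nonneg_nonneg suminf_nonneg summ) auto
  have "(\<integral>\<^sup>+w. ennreal (indicator A w *\<^sub>R g w) \<partial>lborel)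
     \<le> (\<integral>\<^sup>+w. (\<Sum>k. ennreal (c k) * indicator (ball a (\<rho> k)) w) \<partial>lborel)"
  proof (rule nn_integral_mono)
    fix w
    show "ennreal (indicator A w *\<^sub>R g w) \<le> (\<Sum>k. ennreal (c k) * indicator (ball a (\<rho> k)) w)"
    proof (cases "w \<in> A")
      case True
      then obtain k where k: "norm (w - a) < \<rho> k" "g w \<le> c k" using bd by blast
      have "ennreal (g w) \<le> ennreal (c k) * indicator (ball a (\<rho> k)) w"
        using k by (auto simp: dist_norm norm_minus_commute intro: ennreal_leI)
      also have "\<dots> \<le> (\<Sum>k. ennreal (c k) * indicator (ball a (\<rho> k)) w)"
      proof -
        define G where "G = (\<lambda>k. ennreal (c k) * indicator (ball a (\<rho> k)) w)"
        have "sum G {k} \<le> suminf G" by (rule sum_le_suminf) auto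
        then have "G k \<le> suminf G" by simp
        then show ?thesis unfolding G_def .
      qed
      finally show ?thesis using True by simp
    qed simp
  qed
  also have "\<dots> = (\<Sum>k. (\<integral>\<^sup>+w. ennreal (c k) * indicator (ball a (\<rho> k)) w \<partial>lborel))"
    by (intro nn_integral_suminf borel_measurable_times_ennreal borel_measurable_const borel_measurable_indicator) simp
  also have "\<dots> = (\<Sum>k. ennreal (pi * (c k * (\<rho> k)\<^sup>2)))"
  proof (intro arg_cong[where f = suminf] ext)
    fix k
    have "emeasure lborel (ball a (\<rho> k)) = ennreal (pi * (\<rho> k)\<^sup>2)"
      using \<rho> by (simp add: emeasure_ball eval_unit_ball_vol)
    then have "(\<integral>\<^sup>+w. ennreal (c k) * indicator (ball a (\<rho> k)) w \<partial>lborel) = ennreal (c k) * ennreal (pi * (\<rho> k)\<^sup>2)"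
      by (simp add: nn_integral_cmult_indicator)
    also have "\<dots> = ennreal (c k * (pi * (\<rho> k)\<^sup>2))"
      using c by (simp add: ennreal_mult'[symmetric])
    finally show "(\<integral>\<^sup>+w. ennreal (c k) * indicator (ball a (\<rho> k)) w \<partial>lborel) = ennreal (pi * (c k * (\<rho> k)\<^sup>2))"
      by (simp only: mult.left_commute)
  qed
  also have "\<dots> = ennreal (\<Sum>k. pi * (c k * (\<rho> k)\<^sup>2))"
    using c summ by (intro suminf_ennreal2 summable_mult) auto
  also have "(\<Sum>k. pi * (c k * (\<rho> k)\<^sup>2)) = ?S"
    using summ by (rule suminf_mult)
  finally have le: "(\<integral>\<^sup>+w. ennreal (indicator A w *\<^sub>R g w) \<partial>lborel) \<le> ennreal ?S" .
  show i: "set_integrable lborel A g"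
    unfolding set_integrable_def
  proof (rule integrableI_bounded)
    have "(\<integral>\<^sup>+w. ennreal (norm (indicator A w *\<^sub>R g w)) \<partial>lborel) = (\<integral>\<^sup>+w. ennreal (indicator A w *\<^sub>R g w) \<partial>lborel)"
      using g0 by simp
    then show "(\<integral>\<^sup>+w. ennreal (norm (indicator A w *\<^sub>R g w)) \<partial>lborel) < \<infinity>"
      using le_less_trans[OF le] by simp
  qed auto
  have "ennreal (LINT w:A|lborel. g w) \<le> ennreal ?S"
    unfolding set_lebesgue_integral_def
    using le i g0 by (subst nn_integral_eq_integral[symmetric]) (auto simp: set_integrable_def)
  then show "(LINT w:A|lborel. g w) \<le> ?S"
    using S0 by (simp add: ennreal_le_iff)
qed

lemma integrable_norm_powr_near:
  fixes a :: complex
  assumes s: "0 \<le> s" "s < 2" and r: "r > 0"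
  shows "set_integrable lborel (ball a r) (\<lambda>w. norm (w - a) powr (-s))"
    and "(LINT w:ball a r|lborel. norm (w - a) powr (-s)) \<le> pi * (\<Sum>k. (r / 2 ^ Suc k) powr (-s) * (r / 2 ^ k)\<^sup>2)"
proof -
  define c where "c = (\<lambda>k. (r / 2 ^ Suc k) powr (-s))"
  define \<rho> where "\<rho> = (\<lambda>k::nat. r / 2 ^ k)"
  have split: "2 powr (s - 2) = 2 powr s * (2 powr (-2::real))"
    by (simp add: powr_add[symmetric])
  have "c k * (\<rho> k)\<^sup>2 = ((r / 2) powr (-s) * r\<^sup>2) * (2 powr (s - 2)) ^ k" for k
  proof -
    have "c k = (r / 2) powr (-s) * (2 powr s) ^ k"
      using r by (simp add: c_def powr_divide powr_mult powr_minus powr_power powr_realpow[symmetric] powr_powr field_simps)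
    moreover have "(\<rho> k)\<^sup>2 = r\<^sup>2 * (2 powr (-2)) ^ k"
    proof -
      have q: "(2::real) powr (-2) = 1 / 4" by (simp add: powr_minus)
      show ?thesis unfolding q by (simp add: \<rho>_def power_divide two_power_squared)
    qed
    moreover have "(2 powr (s - 2)) ^ k = (2 powr s) ^ k * (2 powr (-2::real)) ^ k"
      unfolding split by (rule power_mult_distrib)
    ultimately show ?thesis by simp
  qed
  moreover have "2 powr (s - 2) < (1::real)" using s by (simp add: powr_less_one)
  ultimately have summ: "summable (\<lambda>k. c k * (\<rho> k)\<^sup>2)"
    by (simp add: summable_mult summable_geometric)
  have bd: "\<exists>k. norm (w - a) < \<rho> k \<and> norm (w - a) powr (-s) \<le> c k" if "w \<in> ball a r" for w
  proof (cases "w = a")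
    case True
    then show ?thesis using r by (intro exI[of _ 0]) (simp add: \<rho>_def c_def)
  next
    case False
    let ?d = "norm (w - a)"
    have d: "0 < ?d" "?d < r" using False that by (auto simp: dist_norm norm_minus_commute)
    have "(\<lambda>k. r / 2 ^ k) \<longlonglongrightarrow> 0"
      using LIMSEQ_divide_realpow_zero[of 2 r] by simp
    then have "eventually (\<lambda>k. r / 2 ^ k < ?d) sequentially"
      using d(1) by (rule order_tendstoD)
    then have ex: "\<exists>k. r / 2 ^ k \<le> ?d" by (auto simp: eventually_sequentially intro: less_imp_le)
    \<comment> \<open>The layer containing \<open>w\<close> lies between the radii \<open>r / 2 ^ Suc k\<close> and \<open>r / 2 ^ k\<close>.\<close>
    define m where "m = (LEAST k. r / 2 ^ k \<le> ?d)"
    have m: "r / 2 ^ m \<le> ?d" unfolding m_def using ex by (rule LeastI_ex)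
    then have "m \<noteq> 0" using d by (metis div_by_1 not_le power_0)
    then obtain k where k: "m = Suc k" by (cases m) auto
    have "\<not> r / 2 ^ k \<le> ?d" using not_less_Least[of k "\<lambda>k. r / 2 ^ k \<le> ?d"] k unfolding m_def by simp
    moreover have "?d powr (-s) \<le> c k"
      unfolding c_def using m k r s by (intro powr_mono2') auto
    ultimately show ?thesis by (intro exI[of _ k]) (simp add: \<rho>_def)
  qed
  have [measurable]: "(\<lambda>w. norm (w - a) powr (-s)) \<in> borel_measurable borel" by measurable
  show "set_integrable lborel (ball a r) (\<lambda>w. norm (w - a) powr (-s))"
    by (rule set_integrable_by_balls[OF _ _ _ _ _ summ bd]) (use r in \<open>auto simp: c_def \<rho>_def\<close>)
  have "(LINT w:ball a r|lborel. norm (w - a) powr (-s)) \<le> pi * (\<Sum>k. c k * (\<rho> k)\<^sup>2)"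
    by (rule set_integrable_by_balls(2)[OF _ _ _ _ _ summ bd]) (use r in \<open>auto simp: c_def \<rho>_def\<close>)
  then show "(LINT w:ball a r|lborel. norm (w - a) powr (-s)) \<le> pi * (\<Sum>k. (r / 2 ^ Suc k) powr (-s) * (r / 2 ^ k)\<^sup>2)"
    by (simp add: c_def \<rho>_def)
qed

lemma integrable_norm_powr_far:
  fixes a :: complex
  assumes s: "s > 2" and r: "r > 0"
  shows "set_integrable lborel (- ball a r) (\<lambda>w. norm (w - a) powr (-s))"
proof -
  define c where "c = (\<lambda>k. (r * 2 ^ k) powr (-s))"
  define \<rho> where "\<rho> = (\<lambda>k::nat. r * 2 ^ Suc k)"
  have split: "2 powr (2 - s) = 2 powr (-s) * (2 powr (2::real))"
    by (simp add: powr_diff powr_minus field_simps)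
  have "c k * (\<rho> k)\<^sup>2 = (r powr (-s) * (2 * r)\<^sup>2) * (2 powr (2 - s)) ^ k" for k
  proof -
    have "c k = r powr (-s) * (2 powr (-s)) ^ k"
      using r by (simp add: c_def powr_mult powr_power powr_realpow[symmetric] powr_powr mult.commute)
    moreover have "((2::real) ^ k)\<^sup>2 = 4 ^ k"
      by (rule two_power_squared)
    then have "(\<rho> k)\<^sup>2 = (2 * r)\<^sup>2 * (2 powr 2) ^ k"
      by (simp add: \<rho>_def power_mult_distrib)
    moreover have "(2 powr (2 - s)) ^ k = (2 powr (-s)) ^ k * (2 powr (2::real)) ^ k"
      unfolding split by (rule power_mult_distrib)
    ultimately show ?thesis by simp
  qed
  moreover have "2 powr (2 - s) < (1::real)" using s by (simp add: powr_less_one)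
  ultimately have summ: "summable (\<lambda>k. c k * (\<rho> k)\<^sup>2)"
    by (simp add: summable_mult summable_geometric)
  have bd: "\<exists>k. norm (w - a) < \<rho> k \<and> norm (w - a) powr (-s) \<le> c k" if "w \<in> - ball a r" for w
  proof -
    let ?d = "norm (w - a)"
    have d: "?d \<ge> r" using that by (auto simp: dist_norm norm_minus_commute)
    obtain n where "?d / r < 2 ^ n" using real_arch_pow[of 2 "?d / r"] by auto
    then have ex: "\<exists>k. ?d < r * 2 ^ k" using r by (auto simp: field_simps)
    \<comment> \<open>The layer containing \<open>w\<close> lies between the radii \<open>r * 2 ^ k\<close> and \<open>r * 2 ^ Suc k\<close>.\<close>
    define m where "m = (LEAST k. ?d < r * 2 ^ k)"
    have m: "?d < r * 2 ^ m" unfolding m_def using ex by (rule LeastI_ex)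
    then have "m \<noteq> 0" using d by (metis mult.right_neutral not_le power_0)
    then obtain k where k: "m = Suc k" by (cases m) auto
    have "\<not> ?d < r * 2 ^ k" using not_less_Least[of k "\<lambda>k. ?d < r * 2 ^ k"] k unfolding m_def by simp
    then have "?d powr (-s) \<le> c k"
      unfolding c_def using r s by (intro powr_mono2') auto
    with m k show ?thesis by (auto simp: \<rho>_def)
  qed
  have [measurable]: "(\<lambda>w. norm (w - a) powr (-s)) \<in> borel_measurable borel" by measurable
  show ?thesis
    by (rule set_integrable_by_balls[OF _ _ _ _ _ summ bd]) (use r in \<open>auto simp: c_def \<rho>_def\<close>)
qed

section \<open>The Bergman space as a Banach space\<close>

text \<open>Point evaluations are bounded, locally uniformly in the point.\<close>

lemma Ap_pointwise_bound:
  assumes p: "1 \<le> p" and "open \<Omega>" and f: "f \<in> Ap p \<Omega>" and r: "r > 0" and sub: "ball z r \<subseteq> \<Omega>"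
  shows "norm (f z) \<le> 32 * (pi * r\<^sup>2) powr (- 1 / p) * Ap_norm p \<Omega> f"
proof -
  have h: "f holomorphic_on \<Omega>" and i: "integrable lborel (\<lambda>z. norm (f z) powr p)"
    using f \<open>open \<Omega>\<close> by (auto simp: Ap_iff)
  have si: "set_integrable lborel (ball z r) (\<lambda>z. norm (f z) powr p)"
    by (rule set_integrable_subset[of lborel UNIV]) (use i in \<open>simp_all add: set_integrable_def\<close>)
  define J where "J = (LINT z|lborel. norm (f z) powr p)"
  have "(norm (f z) / 32) powr p * (pi * r\<^sup>2) \<le> (LINT w:ball z r|lborel. norm (f w) powr p)"
    using h sub by (intro powr_norm_le_area_integral p r si) (rule holomorphic_on_subset)
  also have "\<dots> \<le> J"
    unfolding set_lebesgue_integral_def J_def using si i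
    by (intro integral_mono) (auto simp: set_integrable_def split: split_indicator)
  finally have "(norm (f z) / 32) powr p \<le> J * (1 / (pi * r\<^sup>2))"
    using r by (simp add: field_simps)
  then have "((norm (f z) / 32) powr p) powr (1 / p) \<le> (J * (1 / (pi * r\<^sup>2))) powr (1 / p)"
    using p by (intro powr_mono2) auto
  also have "((norm (f z) / 32) powr p) powr (1 / p) = norm (f z) / 32"
    using p by (simp add: powr_powr)
  also have "(J * (1 / (pi * r\<^sup>2))) powr (1 / p) = J powr (1 / p) * (1 / (pi * r\<^sup>2)) powr (1 / p)"
    by (rule powr_mult)
  also have "(1 / (pi * r\<^sup>2)) powr (1 / p) = (pi * r\<^sup>2) powr (- 1 / p)"
    using r by (simp add: powr_divide powr_minus_divide)
  also have "J powr (1 / p) = Ap_norm p \<Omega> f"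
    unfolding J_def using \<open>open \<Omega>\<close> f by (rule Ap_norm_eq[symmetric])
  finally show ?thesis by (simp add: field_simps)
qed

lemma Ap_subspace:
  assumes p: "1 \<le> p" and "open \<Omega>"
  shows "cfun.subspace (Ap p \<Omega>)"
proof (rule cfun.subspaceI)
  show "0 \<in> Ap p \<Omega>" using p by (simp add: Ap_iff[OF \<open>open \<Omega>\<close>] zero_fun_def)
next
  fix f g assume fg: "f \<in> Ap p \<Omega>" "g \<in> Ap p \<Omega>"
  then have [measurable]: "f \<in> borel_measurable borel" "g \<in> borel_measurable borel"
    using \<open>open \<Omega>\<close> by (auto simp: Ap_iff intro: holomorphic_extension_borel_measurable)
  have "integrable lborel (\<lambda>z. norm (f z + g z) powr p)"
  proof (rule Bochner_Integration.integrable_bound)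
    show "integrable lborel (\<lambda>z. 2 powr p * (norm (f z) powr p + norm (g z) powr p))"
      using fg by (auto simp: Ap_iff[OF \<open>open \<Omega>\<close>])
    have "norm (f z + g z) powr p \<le> 2 powr p * (norm (f z) powr p + norm (g z) powr p)" for z
    proof -
      have "norm (f z + g z) powr p \<le> (norm (f z) + norm (g z)) powr p"
        using p by (intro powr_mono2) (auto intro: norm_triangle_ineq)
      also have "\<dots> \<le> 2 powr p * (norm (f z) powr p + norm (g z) powr p)"
        using p by (intro powr_add_le) auto
      finally show ?thesis .
    qed
    then show "AE z in lborel. norm (norm (f z + g z) powr p)
        \<le> norm (2 powr p * (norm (f z) powr p + norm (g z) powr p))"
      by simp
  qed measurable
  then show "f + g \<in> Ap p \<Omega>"
    using fg by (auto simp: Ap_iff[OF \<open>open \<Omega>\<close>] plus_fun_def intro!: holomorphic_intros)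
next
  fix c f assume "f \<in> Ap p \<Omega>"
  then show "cfun_scale c f \<in> Ap p \<Omega>"
    by (auto simp: Ap_iff[OF \<open>open \<Omega>\<close>] cfun_scale_def norm_mult powr_mult intro!: holomorphic_intros)
qed

lemma Ap_norm_eq_0_iff:
  assumes p: "1 \<le> p" and "open \<Omega>" and f: "f \<in> Ap p \<Omega>"
  shows "Ap_norm p \<Omega> f = 0 \<longleftrightarrow> f = 0"
proof
  assume 0: "Ap_norm p \<Omega> f = 0"
  show "f = 0"
  proof
    fix z
    show "f z = 0 z"
    proof (cases "z \<in> \<Omega>")
      case True
      then obtain r where "r > 0" "ball z r \<subseteq> \<Omega>"
        using \<open>open \<Omega>\<close> open_contains_ball by blast
      from Ap_pointwise_bound[OF p \<open>open \<Omega>\<close> f this] show ?thesis using 0 by simp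
    qed (use f \<open>open \<Omega>\<close> in \<open>auto simp: Ap_iff\<close>)
  qed
next
  assume "f = 0"
  then show "Ap_norm p \<Omega> f = 0" by (simp add: Ap_norm_def)
qed

lemma Ap_norm_powr:
  assumes p: "1 \<le> p" and "open \<Omega>" and f: "f \<in> Ap p \<Omega>"
  shows "Ap_norm p \<Omega> f powr p = (LINT z|lborel. norm (f z) powr p)"
proof -
  have "(LINT z|lborel. norm (f z) powr p) \<ge> 0" by (intro Bochner_Integration.integral_nonneg) auto
  then show ?thesis using p by (simp add: Ap_norm_eq[OF assms(2,3)] powr_powr)
qed

lemma Ap_norm_scale:
  assumes p: "1 \<le> p" and "open \<Omega>" and f: "f \<in> Ap p \<Omega>"
  shows "Ap_norm p \<Omega> (cfun_scale c f) = norm c * Ap_norm p \<Omega> f"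
proof -
  have "cfun_scale c f \<in> Ap p \<Omega>"
    using Ap_subspace[OF p \<open>open \<Omega>\<close>] f by (rule cfun.subspace_scale)
  then have "Ap_norm p \<Omega> (cfun_scale c f) = (LINT z|lborel. norm (cfun_scale c f z) powr p) powr (1 / p)"
    by (rule Ap_norm_eq[OF \<open>open \<Omega>\<close>])
  also have "(LINT z|lborel. norm (cfun_scale c f z) powr p) = norm c powr p * (LINT z|lborel. norm (f z) powr p)"
    by (simp add: cfun_scale_def norm_mult powr_mult)
  also have "\<dots> powr (1 / p) = (norm c powr p) powr (1 / p) * (LINT z|lborel. norm (f z) powr p) powr (1 / p)"
    by (rule powr_mult)
  also have "\<dots> = norm c * Ap_norm p \<Omega> f"
    using p by (simp add: powr_powr Ap_norm_eq[OF \<open>open \<Omega>\<close> f])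
  finally show ?thesis .
qed

text \<open>Minkowski's inequality: with \<open>a\<close>, \<open>b\<close> the norms of \<open>f\<close>, \<open>g\<close>, the function \<open>(f + g) / (a + b)\<close> is
  dominated by a convex combination of \<open>\<bar>f\<bar> / a\<close> and \<open>\<bar>g\<bar> / b\<close>, and \<open>x\<^sup>p\<close> is convex.\<close>

lemma Ap_norm_triangle:
  assumes p: "1 \<le> p" and "open \<Omega>" and f: "f \<in> Ap p \<Omega>" and g: "g \<in> Ap p \<Omega>"
  shows "Ap_norm p \<Omega> (f + g) \<le> Ap_norm p \<Omega> f + Ap_norm p \<Omega> g"
proof -
  define a b where "a = Ap_norm p \<Omega> f" and "b = Ap_norm p \<Omega> g"
  have ab0: "a \<ge> 0" "b \<ge> 0" by (simp_all add: a_def b_def Ap_norm_def)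
  consider "a = 0" | "b = 0" | "a > 0" "b > 0" using ab0 by linarith
  then show ?thesis
  proof cases
    case 1
    then have "f = 0" using Ap_norm_eq_0_iff[OF p \<open>open \<Omega>\<close> f] by (simp add: a_def)
    then show ?thesis by (simp add: Ap_norm_def)
  next
    case 2
    then have "g = 0" using Ap_norm_eq_0_iff[OF p \<open>open \<Omega>\<close> g] by (simp add: b_def)
    then show ?thesis by (simp add: Ap_norm_def)
  next
    case 3
    define u v where "u = a / (a + b)" and "v = b / (a + b)"
    have uv: "u \<ge> 0" "v \<ge> 0" "u + v = 1"
      using 3 by (simp_all add: u_def v_def add_divide_distrib[symmetric])
    have fg: "f + g \<in> Ap p \<Omega>" using Ap_subspace[OF p \<open>open \<Omega>\<close>] f g by (rule cfun.subspace_add)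
    have int: "integrable lborel (\<lambda>z. norm (h z) powr p)" if "h \<in> Ap p \<Omega>" for h
      using that by (simp add: Ap_iff[OF \<open>open \<Omega>\<close>])
    have bd: "norm ((f + g) z) powr p \<le>
       (a + b) powr p * (u * (norm (f z) powr p / a powr p) + v * (norm (g z) powr p / b powr p))" for z
    proof -
      have "norm ((f + g) z) powr p \<le> (norm (f z) + norm (g z)) powr p"
        using p by (intro powr_mono2) (auto intro: norm_triangle_ineq)
      also have "norm (f z) + norm (g z) = (a + b) * (u * (norm (f z) / a) + v * (norm (g z) / b))"
      proof -
        have "(a + b) * (u * (x / a)) = x" "(a + b) * (v * (x / b)) = x" for x
          using 3 by (simp_all add: u_def v_def)
        then show ?thesis by (simp only: distrib_left)
      qed
      also have "\<dots> powr p = (a + b) powr p * (u * (norm (f z) / a) + v * (norm (g z) / b)) powr p"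
        by (rule powr_mult)
      also have "\<dots> \<le> (a + b) powr p * (u * (norm (f z) / a) powr p + v * (norm (g z) / b) powr p)"
        using 3 uv p by (intro mult_left_mono powr_convex_combination) auto
      finally show ?thesis using 3 by (simp add: powr_divide)
    qed
    have "Ap_norm p \<Omega> (f + g) powr p = (LINT z|lborel. norm ((f + g) z) powr p)"
      using p \<open>open \<Omega>\<close> fg by (rule Ap_norm_powr)
    also have "\<dots> \<le> (LINT z|lborel. (a + b) powr p * (u * (norm (f z) powr p / a powr p) + v * (norm (g z) powr p / b powr p)))"
      using int[OF f] int[OF g] int[OF fg] bd by (intro integral_mono) auto
    also have "\<dots> = (a + b) powr p * (u * ((LINT z|lborel. norm (f z) powr p) / a powr p)
        + v * ((LINT z|lborel. norm (g z) powr p) / b powr p))"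
      using int[OF f] int[OF g] by simp
    also have "\<dots> = (a + b) powr p"
      using 3 uv by (simp add: Ap_norm_powr[OF p \<open>open \<Omega>\<close>, symmetric] f g flip: a_def b_def)
    finally have "(Ap_norm p \<Omega> (f + g) powr p) powr (1 / p) \<le> ((a + b) powr p) powr (1 / p)"
      using p by (simp add: powr_mono2)
    moreover have "Ap_norm p \<Omega> (f + g) \<ge> 0" by (simp add: Ap_norm_def)
    ultimately show ?thesis using p 3
      by (simp add: powr_powr flip: a_def b_def)
  qed
qed

lemma Ap_normed_space:
  assumes "1 \<le> p" and "open \<Omega>"
  shows "complex_normed_space_on (Ap p \<Omega>) (Ap_norm p \<Omega>)"
  unfolding complex_normed_space_on_def
proof (intro conjI ballI allI)
  show "0 \<le> Ap_norm p \<Omega> f" for f by (simp add: Ap_norm_def)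
qed (use Ap_subspace[OF assms] Ap_norm_eq_0_iff[OF assms] Ap_norm_scale[OF assms] Ap_norm_triangle[OF assms]
  in \<open>blast+\<close>)

lemma Ap_Metric_space:
  assumes p: "1 \<le> p" and "open \<Omega>"
  shows "Metric_space (Ap p \<Omega>) (\<lambda>f g. Ap_norm p \<Omega> (f - g))"
proof
  show "0 \<le> Ap_norm p \<Omega> (f - g)" for f g by (simp add: Ap_norm_def)
  show "Ap_norm p \<Omega> (f - g) = Ap_norm p \<Omega> (g - f)" for f g
    by (simp add: Ap_norm_def norm_minus_commute)
  have diff: "f - g \<in> Ap p \<Omega>" if "f \<in> Ap p \<Omega>" "g \<in> Ap p \<Omega>" for f g
    using Ap_subspace[OF assms] that by (rule cfun.subspace_diff)
  show "Ap_norm p \<Omega> (f - g) = 0 \<longleftrightarrow> f = g" if "f \<in> Ap p \<Omega>" "g \<in> Ap p \<Omega>" for f g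
    using Ap_norm_eq_0_iff[OF assms diff[OF that]] by simp
  show "Ap_norm p \<Omega> (f - h) \<le> Ap_norm p \<Omega> (f - g) + Ap_norm p \<Omega> (g - h)"
    if "f \<in> Ap p \<Omega>" "g \<in> Ap p \<Omega>" "h \<in> Ap p \<Omega>" for f g h
    using Ap_norm_triangle[OF assms diff[OF that(1,2)] diff[OF that(2,3)]] by simp
qed

lemma Ap_Cauchy_uniform_limit:
  assumes p: "1 \<le> p" and "open \<Omega>" and \<sigma>: "\<And>n. \<sigma> n \<in> Ap p \<Omega>"
    and C: "\<And>e. e > 0 \<Longrightarrow> \<exists>N. \<forall>m\<ge>N. \<forall>n\<ge>N. Ap_norm p \<Omega> (\<sigma> m - \<sigma> n) < e"
    and z: "z \<in> \<Omega>"
  shows "\<exists>d>0. cball z d \<subseteq> \<Omega> \<and> uniform_limit (cball z d) \<sigma> (\<lambda>w. lim (\<lambda>n. \<sigma> n w)) sequentially"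
proof -
  obtain e where e: "e > 0" "ball z e \<subseteq> \<Omega>" using z \<open>open \<Omega>\<close> open_contains_ball by blast
  define d where "d = e / 2"
  have d: "d > 0" using e by (simp add: d_def)
  have bsub: "ball w d \<subseteq> \<Omega>" if "w \<in> cball z d" for w
  proof -
    have "ball w d \<subseteq> ball z e"
      using that by (auto simp: ball_subset_ball_iff d_def dist_commute)
    then show ?thesis using e by blast
  qed
  define K where "K = 32 * (pi * d\<^sup>2) powr (- 1 / p)"
  have K: "K > 0" using d by (simp add: K_def)
  have diff: "\<sigma> m - \<sigma> n \<in> Ap p \<Omega>" for m n
    using Ap_subspace[OF assms(1,2)] \<sigma> \<sigma> by (rule cfun.subspace_diff)
  have bd: "dist (\<sigma> m w) (\<sigma> n w) \<le> K * Ap_norm p \<Omega> (\<sigma> m - \<sigma> n)" if "w \<in> cball z d" for m n w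
    using Ap_pointwise_bound[OF p \<open>open \<Omega>\<close> diff d bsub[OF that], of m n] by (simp add: K_def dist_norm)
  have "uniformly_Cauchy_on (cball z d) \<sigma>"
  proof (rule uniformly_Cauchy_onI)
    fix \<epsilon> :: real assume "\<epsilon> > 0"
    then have "\<epsilon> / K > 0" using K by simp
    then obtain N where N: "\<forall>m\<ge>N. \<forall>n\<ge>N. Ap_norm p \<Omega> (\<sigma> m - \<sigma> n) < \<epsilon> / K" using C by blast
    have "dist (\<sigma> m w) (\<sigma> n w) < \<epsilon>" if "w \<in> cball z d" "m \<ge> N" "n \<ge> N" for w m n
    proof -
      have "K * Ap_norm p \<Omega> (\<sigma> m - \<sigma> n) < \<epsilon>" using N that K by (simp add: field_simps)
      then show ?thesis using bd[OF that(1), of m n] by linarith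
    qed
    then show "\<exists>M. \<forall>w\<in>cball z d. \<forall>m\<ge>M. \<forall>n\<ge>M. dist (\<sigma> m w) (\<sigma> n w) < \<epsilon>" by blast
  qed
  then have "uniform_limit (cball z d) \<sigma> (\<lambda>w. lim (\<lambda>n. \<sigma> n w)) sequentially"
    by (intro Cauchy_uniformly_convergent[unfolded uniformly_convergent_uniform_limit_iff])
  moreover have "cball z d \<subseteq> \<Omega>"
    using e by (auto simp: d_def intro!: subsetD[OF e(2)])
  ultimately show ?thesis using d by blast
qed

text \<open>The locally uniform limit of a Cauchy sequence is holomorphic, and Fatou's lemma shows that it is
  also the limit in norm.\<close>

lemma Ap_complete:
  assumes p: "1 \<le> p" and "open \<Omega>"
  shows "Metric_space.mcomplete (Ap p \<Omega>) (\<lambda>f g. Ap_norm p \<Omega> (f - g))"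
proof -
  note ms = Ap_Metric_space[OF assms]
  show ?thesis
    unfolding Metric_space.mcomplete_def[OF ms]
  proof (intro allI impI)
    fix \<sigma> assume "Metric_space.MCauchy (Ap p \<Omega>) (\<lambda>f g. Ap_norm p \<Omega> (f - g)) \<sigma>"
    note MC = this[unfolded Metric_space.MCauchy_def[OF ms]]
    have \<sigma>: "\<sigma> n \<in> Ap p \<Omega>" for n
      using MC by auto
    have C: "\<exists>N. \<forall>m\<ge>N. \<forall>n\<ge>N. Ap_norm p \<Omega> (\<sigma> m - \<sigma> n) < e" if "e > 0" for e
      using MC that by meson
    have diff: "f - g \<in> Ap p \<Omega>" if "f \<in> Ap p \<Omega>" "g \<in> Ap p \<Omega>" for f g
      using Ap_subspace[OF assms] that by (rule cfun.subspace_diff)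
    define g where "g = (\<lambda>z. if z \<in> \<Omega> then lim (\<lambda>n. \<sigma> n z) else 0)"
    have u: "\<exists>d>0. cball z d \<subseteq> \<Omega> \<and> uniform_limit (cball z d) \<sigma> g sequentially" if z: "z \<in> \<Omega>" for z
    proof -
      obtain d where d: "d > 0" "cball z d \<subseteq> \<Omega>" "uniform_limit (cball z d) \<sigma> (\<lambda>w. lim (\<lambda>n. \<sigma> n w)) sequentially"
        using Ap_Cauchy_uniform_limit[OF assms \<sigma> C z] by blast
      moreover have "uniform_limit (cball z d) \<sigma> g sequentially \<longleftrightarrow>
          uniform_limit (cball z d) \<sigma> (\<lambda>w. lim (\<lambda>n. \<sigma> n w)) sequentially"
        using d(2) by (intro uniform_limit_cong') (auto simp: g_def)
      ultimately show ?thesis by blast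
    qed
    have holg: "g holomorphic_on \<Omega>"
      by (rule holomorphic_uniform_sequence[OF \<open>open \<Omega>\<close> _ u])
        (use \<sigma> in \<open>auto simp: Ap_iff[OF \<open>open \<Omega>\<close>]\<close>)
    have g0: "g z = 0" if "z \<notin> \<Omega>" for z using that by (simp add: g_def)
    have \<sigma>0: "\<sigma> n z = 0" if "z \<notin> \<Omega>" for n z using \<sigma>[of n] that by (simp add: Ap_iff[OF \<open>open \<Omega>\<close>])
    have lim: "(\<lambda>m. \<sigma> m z) \<longlonglongrightarrow> g z" for z
    proof (cases "z \<in> \<Omega>")
      case True
      then obtain d where "d > 0" "uniform_limit (cball z d) \<sigma> g sequentially" using u by blast
      then show ?thesis by (intro tendsto_uniform_limitI[where S = "cball z d"]) auto
    qed (simp add: g0 \<sigma>0)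
    have [measurable]: "\<sigma> n \<in> borel_measurable borel" for n
      using \<sigma>[of n] \<open>open \<Omega>\<close> by (auto simp: Ap_iff intro: holomorphic_extension_borel_measurable)
    have [measurable]: "g \<in> borel_measurable borel"
      using \<open>open \<Omega>\<close> holg g0 by (rule holomorphic_extension_borel_measurable)
    have key: "\<exists>N. \<forall>n\<ge>N. \<sigma> n - g \<in> Ap p \<Omega> \<and> Ap_norm p \<Omega> (\<sigma> n - g) \<le> e" if e: "e > 0" for e
    proof -
      obtain N where N: "\<forall>m\<ge>N. \<forall>n\<ge>N. Ap_norm p \<Omega> (\<sigma> m - \<sigma> n) < e" using C[OF e] by blast
      have "\<sigma> n - g \<in> Ap p \<Omega> \<and> Ap_norm p \<Omega> (\<sigma> n - g) \<le> e" if n: "n \<ge> N" for n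
      proof -
        have tl: "(\<lambda>m. ennreal (norm (\<sigma> n z - \<sigma> m z) powr p)) \<longlonglongrightarrow> ennreal (norm (\<sigma> n z - g z) powr p)" for z
          using p by (intro tendsto_ennrealI tendsto_powr' tendsto_norm tendsto_diff tendsto_const lim) auto
        have "(\<integral>\<^sup>+z. ennreal (norm (\<sigma> n z - g z) powr p) \<partial>lborel)
            = (\<integral>\<^sup>+z. liminf (\<lambda>m. ennreal (norm (\<sigma> n z - \<sigma> m z) powr p)) \<partial>lborel)"
          using lim_imp_Liminf[OF _ tl] by (intro nn_integral_cong) auto
        also have "\<dots> \<le> liminf (\<lambda>m. \<integral>\<^sup>+z. ennreal (norm (\<sigma> n z - \<sigma> m z) powr p) \<partial>lborel)"
          by (intro nn_integral_liminf) measurable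
        also have "\<dots> \<le> ennreal (e powr p)"
        proof (rule Liminf_le)
          show "eventually (\<lambda>m. (\<integral>\<^sup>+z. ennreal (norm (\<sigma> n z - \<sigma> m z) powr p) \<partial>lborel) \<le> ennreal (e powr p)) sequentially"
            using eventually_ge_at_top[of N]
          proof eventually_elim
            case (elim m)
            have D: "\<sigma> n - \<sigma> m \<in> Ap p \<Omega>" using diff \<sigma> by blast
            have "Ap_norm p \<Omega> (\<sigma> n - \<sigma> m) \<le> e" using N n elim by (simp add: less_imp_le)
            then have "Ap_norm p \<Omega> (\<sigma> n - \<sigma> m) powr p \<le> e powr p"
              using p by (intro powr_mono2) (auto simp: Ap_norm_def)
            then have "(LINT z|lborel. norm (\<sigma> n z - \<sigma> m z) powr p) \<le> e powr p"
              by (simp add: Ap_norm_powr[OF assms D])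
            moreover have "integrable lborel (\<lambda>z. norm (\<sigma> n z - \<sigma> m z) powr p)"
              using D by (simp add: Ap_iff[OF \<open>open \<Omega>\<close>])
            ultimately show ?case by (subst nn_integral_eq_integral) (auto intro: ennreal_leI)
          qed
        qed simp
        finally have le: "(\<integral>\<^sup>+z. ennreal (norm (\<sigma> n z - g z) powr p) \<partial>lborel) \<le> ennreal (e powr p)" .
        have int: "integrable lborel (\<lambda>z. norm (\<sigma> n z - g z) powr p)"
          using le_less_trans[OF le] by (intro integrableI_bounded) auto
        then have mem: "\<sigma> n - g \<in> Ap p \<Omega>"
          using holg g0 \<sigma>0 \<sigma>[of n] by (auto simp: Ap_iff[OF \<open>open \<Omega>\<close>] fun_diff_def intro!: holomorphic_intros)
        have "Ap_norm p \<Omega> (\<sigma> n - g) powr p \<le> e powr p"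
          using le int unfolding Ap_norm_powr[OF assms mem]
          by (subst (asm) nn_integral_eq_integral) (auto simp: ennreal_le_iff)
        then have "Ap_norm p \<Omega> (\<sigma> n - g) \<le> e"
          using powr_less_mono2[of p e "Ap_norm p \<Omega> (\<sigma> n - g)"] p e by linarith
        with mem show ?thesis by blast
      qed
      then show ?thesis by blast
    qed
    obtain n where "\<sigma> n - g \<in> Ap p \<Omega>" using key[of 1] by auto
    then have "\<sigma> n - (\<sigma> n - g) \<in> Ap p \<Omega>" using \<sigma> diff by blast
    then have gA: "g \<in> Ap p \<Omega>" by simp
    have "\<exists>N. \<forall>n\<ge>N. \<sigma> n \<in> Ap p \<Omega> \<and> Ap_norm p \<Omega> (\<sigma> n - g) < e" if "e > 0" for e
    proof -
      obtain N where N: "\<forall>n\<ge>N. \<sigma> n - g \<in> Ap p \<Omega> \<and> Ap_norm p \<Omega> (\<sigma> n - g) \<le> e / 2"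
        using key[of "e / 2"] half_gt_zero[OF \<open>e > 0\<close>] by blast
      have "\<sigma> n \<in> Ap p \<Omega> \<and> Ap_norm p \<Omega> (\<sigma> n - g) < e" if "n \<ge> N" for n
        using N[rule_format, OF that] \<sigma>[of n] \<open>e > 0\<close> by auto
      then show ?thesis by blast
    qed
    then show "\<exists>g. limitin (Metric_space.mtopology (Ap p \<Omega>) (\<lambda>f g. Ap_norm p \<Omega> (f - g))) \<sigma> g sequentially"
      using gA unfolding Metric_space.limit_metric_sequentially[OF ms] by blast
  qed
qed

lemma Ap_banach:
  assumes "1 \<le> p" and "open \<Omega>"
  shows "complex_banach_space_on (Ap p \<Omega>) (Ap_norm p \<Omega>)"
  unfolding complex_banach_space_on_def
  using Ap_normed_space[OF assms] Ap_Metric_space[OF assms] Ap_complete[OF assms] by blast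

section \<open>Linear relations between functions\<close>

lemma sum_fun_apply: "(sum F A) z = (\<Sum>i\<in>A. F i z)"
  for F :: "'i \<Rightarrow> complex \<Rightarrow> complex"
  by (induction A rule: infinite_finite_induct) auto

text \<open>A family without nontrivial pointwise relation is injective with independent range. Relations are
  indexed by the family, not by its range, so repeated members count as a relation.\<close>

lemma family_independent:
  fixes u :: "'i \<Rightarrow> complex \<Rightarrow> complex"
  assumes I: "finite I"
    and rel: "\<And>\<gamma> i. (\<And>z. (\<Sum>j\<in>I. \<gamma> j * u j z) = 0) \<Longrightarrow> i \<in> I \<Longrightarrow> \<gamma> i = 0"
  shows "inj_on u I" and "cfun.independent (u ` I)"
proof -
  show inj: "inj_on u I"
  proof (rule inj_onI, rule ccontr)
    fix i j assume ij: "i \<in> I" "j \<in> I" "u i = u j" "i \<noteq> j"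
    define \<gamma> where "\<gamma> = (\<lambda>l. if l = i then 1 else if l = j then -1 else (0::complex))"
    have "(\<Sum>l\<in>I. \<gamma> l * u l z) = 0" for z
    proof -
      have "(\<Sum>l\<in>I. \<gamma> l * u l z) = (\<Sum>l\<in>{i, j}. \<gamma> l * u l z)"
        using I ij by (intro sum.mono_neutral_right) (auto simp: \<gamma>_def)
      also have "\<dots> = 0" using ij by (simp add: \<gamma>_def)
      finally show ?thesis .
    qed
    from rel[of \<gamma>, OF this ij(1)] show False by (simp add: \<gamma>_def)
  qed
  show "cfun.independent (u ` I)"
  proof
    assume "cfun.dependent (u ` I)"
    then obtain c v where c: "v \<in> u ` I" "c v \<noteq> 0" "(\<Sum>v\<in>u ` I. cfun_scale (c v) v) = 0"
      using I by (auto simp: cfun.dependent_finite)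
    have "(\<Sum>j\<in>I. c (u j) * u j z) = 0" for z
    proof -
      have "(\<Sum>j\<in>I. c (u j) * u j z) = (\<Sum>v\<in>u ` I. cfun_scale (c v) v z)"
        by (simp add: sum.reindex[OF inj] cfun_scale_def)
      also have "\<dots> = (\<Sum>v\<in>u ` I. cfun_scale (c v) v) z" by (simp add: sum_fun_apply)
      finally show ?thesis using c by simp
    qed
    moreover obtain i where "i \<in> I" "v = u i" using c by blast
    ultimately show False using rel[of "\<lambda>j. c (u j)" i] c by simp
  qed
qed

lemma finite_dimensional_relation:
  fixes u :: "nat \<Rightarrow> complex \<Rightarrow> complex"
  assumes V: "\<not> infinite_dimensional V" and u: "\<And>i. u i \<in> V"
  obtains n \<gamma> i where "i \<le> n" "\<gamma> i \<noteq> 0" "\<And>z. (\<Sum>j\<le>n. \<gamma> j * u j z) = 0"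
proof -
  obtain B where B: "finite B" "cfun.span B = V"
    using V by (auto simp: infinite_dimensional_def)
  define n where "n = card B"
  have "\<exists>\<gamma> i. i \<in> {..n} \<and> \<gamma> i \<noteq> 0 \<and> (\<forall>z. (\<Sum>j\<le>n. \<gamma> j * u j z) = 0)"
  proof (rule ccontr)
    assume "\<not> ?thesis"
    then have rel: "\<And>\<gamma> i. (\<And>z. (\<Sum>j\<in>{..n}. \<gamma> j * u j z) = 0) \<Longrightarrow> i \<in> {..n} \<Longrightarrow> \<gamma> i = 0"
      by blast
    have "inj_on u {..n}" by (rule family_independent(1)) (auto intro: rel)
    have "cfun.independent (u ` {..n})" by (rule family_independent(2)) (auto intro: rel)
    moreover have "u ` {..n} \<subseteq> cfun.span B" using u B by auto
    ultimately have "card (u ` {..n}) \<le> card B"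
      using cfun.independent_span_bound[OF B(1)] by blast
    with \<open>inj_on u {..n}\<close> show False by (simp add: card_image n_def)
  qed
  then show ?thesis using that by auto
qed

section \<open>Functions on finitely punctured planes\<close>

lemma puncture_decay_power:
  fixes f :: "complex \<Rightarrow> complex"
  assumes p: "1 \<le> p" and "finite S" and f: "f holomorphic_on - S"
    and int: "set_integrable lborel (- S) (\<lambda>w. norm (f w) powr p)"
    and m: "2 \<le> real m * p"
  shows "((\<lambda>z. (z - a) ^ m * f z) \<longlongrightarrow> 0) (at a)"
proof -
  obtain R where R: "R > 0" "\<And>x. x \<in> S \<Longrightarrow> x \<noteq> a \<Longrightarrow> R \<le> dist a x"
    using finite_set_avoid[OF \<open>finite S\<close>, of a] by auto
  then have sub: "ball a R - {a} \<subseteq> - S" by force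
  have "((\<lambda>z. norm (z - a) ^ 2 * norm (f z) powr p) \<longlongrightarrow> 0) (at a)"
    using f int sub R by (intro puncture_decay[OF p]) (auto intro: holomorphic_on_subset set_integrable_subset)
  then have "((\<lambda>z. (norm (z - a) ^ 2 * norm (f z) powr p) powr (1 / p)) \<longlongrightarrow> 0 powr (1 / p)) (at a)"
    using p by (intro tendsto_powr' tendsto_const) auto
  then have lim: "((\<lambda>z. (norm (z - a) ^ 2 * norm (f z) powr p) powr (1 / p)) \<longlongrightarrow> 0) (at a)" by simp
  show ?thesis
  proof (rule Lim_null_comparison[OF _ lim])
    have "eventually (\<lambda>z. z \<in> ball a 1 - {a}) (at a)"
      using eventually_at_ball'[of 1 a UNIV] by (auto elim!: eventually_mono)
    then show "eventually (\<lambda>z. norm ((z - a) ^ m * f z) \<le> (norm (z - a) ^ 2 * norm (f z) powr p) powr (1 / p)) (at a)"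
    proof eventually_elim
      case (elim z)
      define d where "d = norm (z - a)"
      have d: "0 < d" "d \<le> 1" using elim by (auto simp: d_def dist_norm norm_minus_commute)
      have "d ^ m = (d powr (real m * p)) powr (1 / p)"
        using d p by (simp add: powr_powr powr_realpow)
      also have "\<dots> \<le> (d powr 2) powr (1 / p)"
        using d p m by (intro powr_mono2 powr_mono') auto
      finally have "d ^ m \<le> (d ^ 2) powr (1 / p)" using d by simp
      moreover have "norm (f z) = (norm (f z) powr p) powr (1 / p)"
        using p by (simp add: powr_powr)
      ultimately have "d ^ m * norm (f z) \<le> (d ^ 2) powr (1 / p) * (norm (f z) powr p) powr (1 / p)"
        by (metis mult_right_mono norm_ge_zero)
      then show ?case by (simp add: norm_mult norm_power d_def powr_mult)
    qed
  qed
qed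

lemma infinity_decay_power:
  fixes f :: "complex \<Rightarrow> complex"
  assumes p: "1 \<le> p" and "finite S" and f: "f holomorphic_on - S"
    and int: "set_integrable lborel (- S) (\<lambda>w. norm (f w) powr p)"
    and m: "real m * p \<le> 2"
  shows "((\<lambda>z. z ^ m * f z) \<longlongrightarrow> 0) at_infinity"
proof -
  obtain R where R: "S \<subseteq> cball 0 R"
    using bounded_subset_ballD[OF finite_imp_bounded[OF \<open>finite S\<close>], of 0] ball_subset_cball by blast
  then have sub: "- cball 0 R \<subseteq> - S" by blast
  have "((\<lambda>z. norm z ^ 2 * norm (f z) powr p) \<longlongrightarrow> 0) at_infinity"
    using f int sub by (intro infinity_decay[OF p, of _ R]) (auto intro: holomorphic_on_subset set_integrable_subset)
  then have "((\<lambda>z. (norm z ^ 2 * norm (f z) powr p) powr (1 / p)) \<longlongrightarrow> 0 powr (1 / p)) at_infinity"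
    using p by (intro tendsto_powr' tendsto_const) auto
  then have lim: "((\<lambda>z. (norm z ^ 2 * norm (f z) powr p) powr (1 / p)) \<longlongrightarrow> 0) at_infinity" by simp
  show ?thesis
  proof (rule Lim_null_comparison[OF _ lim])
    have "eventually (\<lambda>z::complex. norm z \<ge> 1) at_infinity"
      by (auto simp: eventually_at_infinity)
    then show "eventually (\<lambda>z. norm (z ^ m * f z) \<le> (norm z ^ 2 * norm (f z) powr p) powr (1 / p)) at_infinity"
    proof eventually_elim
      case (elim z)
      define d where "d = norm z"
      have d: "1 \<le> d" using elim by (simp add: d_def)
      have "d ^ m = (d powr (real m * p)) powr (1 / p)"
        using d p by (simp add: powr_powr powr_realpow)
      also have "\<dots> \<le> (d powr 2) powr (1 / p)"
        using d p m by (intro powr_mono2 powr_mono) auto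
      finally have "d ^ m \<le> (d ^ 2) powr (1 / p)" using d by simp
      moreover have "norm (f z) = (norm (f z) powr p) powr (1 / p)"
        using p by (simp add: powr_powr)
      ultimately have "d ^ m * norm (f z) \<le> (d ^ 2) powr (1 / p) * (norm (f z) powr p) powr (1 / p)"
        by (metis mult_right_mono norm_ge_zero)
      then show ?case by (simp add: norm_mult norm_power d_def powr_mult)
    qed
  qed
qed

lemma removable_singularities:
  fixes g :: "complex \<Rightarrow> complex"
  assumes "finite S" and "g holomorphic_on - S"
    and "\<And>a. a \<in> S \<Longrightarrow> ((\<lambda>z. (z - a) * g z) \<longlongrightarrow> 0) (at a)"
  shows "\<exists>h. h holomorphic_on UNIV \<and> (\<forall>z. z \<notin> S \<longrightarrow> h z = g z)"
  using assms
proof (induction S arbitrary: g rule: finite_induct)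
  case empty
  then show ?case by auto
next
  case (insert a S)
  have "- insert a S = - S - {a}" by blast
  then have hol: "g holomorphic_on (- S - {a})" using insert.prems by simp
  have op: "open (- S)" using insert.hyps by (simp add: finite_imp_closed open_Compl)
  then have "a \<in> interior (- S)" using insert.hyps by (simp add: interior_open)
  from holomorphic_on_extend_lim[OF hol this] insert.prems(2)[of a]
  obtain g' where g': "g' holomorphic_on - S" "\<And>z. z \<in> - S - {a} \<Longrightarrow> g' z = g z" by auto
  have "((\<lambda>z. (z - b) * g' z) \<longlongrightarrow> 0) (at b)" if b: "b \<in> S" for b
  proof -
    have "open (- (insert a S - {b}))"
      using insert.hyps by (intro open_Compl finite_imp_closed) auto
    moreover have "b \<in> - (insert a S - {b})" by auto
    ultimately have "eventually (\<lambda>z. z \<in> - (insert a S - {b}) - {b}) (at b)"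
      by (rule eventually_at_in_open)
    then have ev: "eventually (\<lambda>z. (z - b) * g z = (z - b) * g' z) (at b)"
      by eventually_elim (use g'(2) in auto)
    show ?thesis
      using insert.prems(2)[of b] b by (subst tendsto_cong[OF ev, symmetric]) auto
  qed
  from insert.IH[OF g'(1) this] obtain h where h: "h holomorphic_on UNIV" "\<And>z. z \<notin> S \<Longrightarrow> h z = g' z"
    by blast
  show ?case using h g'(2) by (intro exI[of _ h]) auto
qed

text \<open>For \<open>p \<ge> 2\<close> the punctures are removable and the resulting entire function tends to \<open>0\<close> at infinity.\<close>

lemma finitely_punctured_plane_trivial:
  fixes f :: "complex \<Rightarrow> complex"
  assumes p: "2 \<le> p" and S: "finite S" and f: "f holomorphic_on - S"
    and int: "set_integrable lborel (- S) (\<lambda>w. norm (f w) powr p)"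
    and z: "z \<notin> S"
  shows "f z = 0"
proof -
  have p1: "1 \<le> p" using p by simp
  have "((\<lambda>z. (z - a) * f z) \<longlongrightarrow> 0) (at a)" for a
    using puncture_decay_power[OF p1 S f int, of 1 a] p by simp
  then obtain h where h: "h holomorphic_on UNIV" "\<And>z. z \<notin> S \<Longrightarrow> h z = f z"
    using removable_singularities[OF S f] by blast
  have "(f \<longlongrightarrow> 0) at_infinity"
    using infinity_decay_power[OF p1 S f int, of 0] by simp
  moreover have "eventually (\<lambda>z. f z = h z) at_infinity"
  proof -
    obtain R where "S \<subseteq> cball 0 R"
      using bounded_subset_ballD[OF finite_imp_bounded[OF S], of 0] ball_subset_cball by blast
    then show ?thesis
      unfolding eventually_at_infinity
    proof (intro exI[of _ "R + 1"] allI impI)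
      fix z :: complex assume "R + 1 \<le> norm z"
      then have "z \<notin> S" using \<open>S \<subseteq> cball 0 R\<close> by auto
      then show "f z = h z" using h(2) by simp
    qed
  qed
  ultimately have "(h \<longlongrightarrow> 0) at_infinity" by (simp add: tendsto_cong)
  then have "h z = 0" using h(1) by (intro Liouville_weak_0)
  then show ?thesis using h(2) z by simp
qed

lemma entire_little_o_polynomial:
  fixes h :: "complex \<Rightarrow> complex"
  assumes h: "h holomorphic_on UNIV" and lim: "((\<lambda>z. h z / z ^ k) \<longlongrightarrow> 0) at_infinity"
  obtains c where "\<And>z. h z = (\<Sum>i<k. c i * z ^ i)"
proof -
  have small: "\<exists>b>0. \<forall>z. norm z \<ge> b \<longrightarrow> norm (h z) \<le> e * norm z ^ k" if e: "e > 0" for e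
  proof -
    obtain b where b: "\<And>z. norm z \<ge> b \<Longrightarrow> norm (h z / z ^ k) < e"
      using lim e unfolding Lim_at_infinity by (metis dist_0_norm dist_commute)
    have "norm (h z) \<le> e * norm z ^ k" if "norm z \<ge> max b 1" for z
    proof -
      have "norm z ^ k > 0" using that by (intro zero_less_power) auto
      then show ?thesis using b[of z] that by (simp add: norm_divide norm_power field_simps)
    qed
    then show ?thesis by (intro exI[of _ "max b 1"]) auto
  qed
  obtain b where b: "\<And>z. norm z \<ge> b \<Longrightarrow> norm (h z) \<le> 1 * norm z ^ k"
    using small[of 1] by auto
  define c where "c = (\<lambda>i. (deriv ^^ i) h 0 / fact i)"
  have h_eq: "h z = (\<Sum>i\<le>k. c i * z ^ i)" for z
    unfolding c_def using h b by (rule Liouville_polynomial)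
  \<comment> \<open>Cauchy's estimate kills the coefficient of \<open>z\<^sup>k\<close>, which Liouville's theorem leaves.\<close>
  have le: "norm ((deriv ^^ k) h 0) \<le> fact k * e" if e: "e > 0" for e
  proof -
    obtain b where b: "b > 0" "\<And>z. norm z \<ge> b \<Longrightarrow> norm (h z) \<le> e * norm z ^ k"
      using small[OF e] by auto
    have "norm ((deriv ^^ k) h 0) \<le> fact k * (e * b ^ k) / b ^ k"
      using h b by (intro Cauchy_inequality)
        (auto intro!: holomorphic_on_imp_continuous_on intro: holomorphic_on_subset)
    then show ?thesis using b by simp
  qed
  have "norm ((deriv ^^ k) h 0) \<le> 0"
  proof (rule field_le_epsilon)
    fix e :: real assume "e > 0"
    then show "norm ((deriv ^^ k) h 0) \<le> 0 + e" using le[of "e / fact k"] by simp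
  qed
  then have "c k = 0" by (simp add: c_def)
  then have "h z = (\<Sum>i<k. c i * z ^ i)" for z
    by (simp add: h_eq lessThan_Suc_atMost[symmetric])
  then show ?thesis using that by blast
qed

text \<open>The plane is covered by small balls around the punctures, the exterior of a large ball, and a
  compact rest on which \<open>f\<close> is continuous.\<close>

lemma Ap_punctured_plane_memI:
  fixes f :: "complex \<Rightarrow> complex"
  assumes p: "0 < p" "p < 2" and S: "finite S" and hol: "f holomorphic_on - S" and zero: "\<And>z. z \<in> S \<Longrightarrow> f z = 0"
    and near: "\<And>a. a \<in> S \<Longrightarrow> \<exists>C. eventually (\<lambda>z. norm (f z) \<le> C / norm (z - a)) (at a)"
    and far: "eventually (\<lambda>z. norm (f z) \<le> D / norm z ^ n) at_infinity" and n: "real n * p > 2"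
  shows "f \<in> Ap p (- S)"
proof -
  have op: "open (- S)" using S by (simp add: finite_imp_closed open_Compl)
  have [measurable]: "f \<in> borel_measurable borel"
    using op hol zero by (intro holomorphic_extension_borel_measurable[of "- S"]) auto
  let ?g = "\<lambda>z. norm (f z) powr p"
  have comp: "set_integrable lborel A ?g" if "set_integrable lborel A h" "A \<in> sets borel"
      "\<And>z. z \<in> A \<Longrightarrow> ?g z \<le> h z" for A h
  proof (rule set_integrable_bound[OF that(1)])
    show "set_borel_measurable lborel A ?g"
      using that(2) unfolding set_borel_measurable_def by measurable
    show "AE x in lborel. x \<in> A \<longrightarrow> norm (?g x) \<le> norm (h x)"
      using that(3) by (force intro: order_trans)
  qed
  have "\<exists>r>0. set_integrable lborel (ball a r) ?g" if a: "a \<in> S" for a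
  proof -
    obtain C where "eventually (\<lambda>z. norm (f z) \<le> C / norm (z - a)) (at a)" using near[OF a] by blast
    then obtain r where r: "r > 0" "\<And>z. z \<noteq> a \<Longrightarrow> dist z a < r \<Longrightarrow> norm (f z) \<le> C / norm (z - a)"
      unfolding eventually_at by auto
    have "set_integrable lborel (ball a r) (\<lambda>z. \<bar>C\<bar> powr p * norm (z - a) powr (- p))"
      using integrable_norm_powr_near(1)[of p r a] p r by auto
    then have "set_integrable lborel (ball a r) ?g"
    proof (rule comp)
      fix z assume z: "z \<in> ball a r"
      show "?g z \<le> \<bar>C\<bar> powr p * norm (z - a) powr (- p)"
      proof (cases "z = a")
        case False
        then have "norm (f z) \<le> C / norm (z - a)" using r(2) z by (auto simp: dist_commute)
        also have "\<dots> \<le> \<bar>C\<bar> / norm (z - a)" by (intro divide_right_mono) auto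
        finally have "?g z \<le> (\<bar>C\<bar> / norm (z - a)) powr p"
          using p by (intro powr_mono2) auto
        then show ?thesis by (simp add: powr_divide powr_minus_divide)
      qed (use zero a in auto)
    qed auto
    then show ?thesis using r by blast
  qed
  then obtain r where r: "\<And>a. a \<in> S \<Longrightarrow> r a > 0" "\<And>a. a \<in> S \<Longrightarrow> set_integrable lborel (ball a (r a)) ?g"
    by metis
  obtain b where b: "\<And>z. norm z \<ge> b \<Longrightarrow> norm (f z) \<le> D / norm z ^ n"
    using far unfolding eventually_at_infinity by auto
  define R where "R = max b 1"
  have R: "R \<ge> 1" "R \<ge> b" by (auto simp: R_def)
  have "set_integrable lborel (- ball 0 R) (\<lambda>z::complex. \<bar>D\<bar> powr p * norm (z - 0) powr (- (real n * p)))"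
    using integrable_norm_powr_far[of "real n * p" R 0] n R by auto
  then have out: "set_integrable lborel (- ball 0 R) ?g"
  proof (rule comp)
    fix z :: complex assume "z \<in> - ball 0 R"
    then have z: "norm z \<ge> R" by auto
    then have "norm (f z) \<le> D / norm z ^ n" using b R by auto
    also have "\<dots> \<le> \<bar>D\<bar> / norm z ^ n" by (intro divide_right_mono) auto
    finally have "?g z \<le> (\<bar>D\<bar> / norm z ^ n) powr p"
      using p by (intro powr_mono2) auto
    also have "\<dots> = \<bar>D\<bar> powr p * norm z powr (- (real n * p))"
    proof -
      have "(norm z ^ n) powr p = norm z powr (real n * p)"
      proof -
        have "norm z powr real n = norm z ^ n" using z R by (intro powr_realpow) linarith
        then show ?thesis by (simp only: powr_powr[symmetric])
      qed
      then show ?thesis by (simp add: powr_divide powr_minus_divide)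
    qed
    finally show "?g z \<le> \<bar>D\<bar> powr p * norm (z - 0) powr (- (real n * p))" by simp
  qed auto
  define K where "K = cball 0 R - (\<Union>a\<in>S. ball a (r a))"
  have K: "compact K" unfolding K_def by (intro compact_diff open_UN) auto
  have "K \<subseteq> - S" using r(1) by (force simp: K_def)
  then have "continuous_on K ?g"
    using p holomorphic_on_imp_continuous_on[OF hol]
    by (intro continuous_on_powr' continuous_intros) (auto intro: continuous_on_subset)
  then have "set_integrable lborel K ?g"
    unfolding set_integrable_def by (rule borel_integrable_compact[OF K])
  then have "set_integrable lborel ((\<Union>a\<in>S. ball a (r a)) \<union> - ball 0 R \<union> K) ?g"
  proof (intro set_integrable_Un set_integrable_UN)
    have "(\<Union>a\<in>S. ball a (r a)) \<in> sets borel" by (intro borel_open open_UN) auto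
    then show "(\<Union>a\<in>S. ball a (r a)) \<union> - ball 0 R \<in> sets lborel" "(\<Union>a\<in>S. ball a (r a)) \<in> sets lborel"
      by auto
  qed (use S r(2) out K in \<open>auto intro: borel_compact\<close>)
  moreover have "(\<Union>a\<in>S. ball a (r a)) \<union> - ball 0 R \<union> K = UNIV"
    by (auto simp: K_def)
  ultimately have "integrable lborel ?g" by (simp add: set_integrable_def)
  then show ?thesis using hol zero by (auto simp: Ap_iff[OF op])
qed

section \<open>Bergman spaces of prescribed finite dimension\<close>

text \<open>The removed points \<open>0, 1, \<dots>, N - 1\<close>; any \<open>N\<close> distinct points would serve.\<close>

definition punctures :: "nat \<Rightarrow> complex set" where
  "punctures N = of_nat ` {..<N}"

text \<open>The monic polynomial whose simple zeros are the removed points.\<close>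

definition puncture_poly :: "nat \<Rightarrow> complex \<Rightarrow> complex" where
  "puncture_poly N z = (\<Prod>j<N. z - of_nat j)"

text \<open>The rational function \<open>z\<^sup>i / Q(z)\<close>, with \<open>Q\<close> the polynomial above, extended by \<open>0\<close> to the
  removed points.\<close>

definition basis_fun :: "nat \<Rightarrow> nat \<Rightarrow> complex \<Rightarrow> complex" where
  "basis_fun N i z = (if z \<in> punctures N then 0 else z ^ i / puncture_poly N z)"

lemma finite_punctures: "finite (punctures N)"
  by (simp add: punctures_def)

lemma open_compl_punctures: "open (- punctures N)"
  by (intro open_Compl finite_imp_closed finite_punctures)

lemma puncture_poly_eq_0_iff: "puncture_poly N z = 0 \<longleftrightarrow> z \<in> punctures N"
  by (auto simp: puncture_poly_def punctures_def)

lemma holomorphic_puncture_poly [holomorphic_intros]: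
  "puncture_poly N holomorphic_on A"
  unfolding puncture_poly_def[abs_def] by (intro holomorphic_intros)

lemma basis_fun_holomorphic: "basis_fun N i holomorphic_on - punctures N"
proof -
  have "(\<lambda>z. z ^ i / puncture_poly N z) holomorphic_on - punctures N"
    by (intro holomorphic_intros) (auto simp: puncture_poly_eq_0_iff)
  then show ?thesis
    by (rule holomorphic_transform) (auto simp: basis_fun_def)
qed

lemma puncture_poly_split:
  assumes "a \<in> punctures N"
  obtains q where "\<And>z. puncture_poly N z = (z - a) * q z" "q a \<noteq> 0" "isCont q a"
proof -
  obtain j where j: "j < N" "a = of_nat j" using assms by (auto simp: punctures_def)
  define q where "q = (\<lambda>z::complex. \<Prod>l\<in>{..<N} - {j}. z - of_nat l)"
  have "puncture_poly N z = (z - a) * q z" for z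
    unfolding puncture_poly_def q_def using j by (simp add: prod.remove)
  moreover have "q a \<noteq> 0" using j by (auto simp: q_def)
  moreover have "isCont q a" unfolding q_def by (intro continuous_intros)
  ultimately show ?thesis by (rule that)
qed

lemma puncture_poly_lower:
  assumes "norm z \<ge> 2 * real N"
  shows "(norm z / 2) ^ N \<le> norm (puncture_poly N z)"
proof -
  have "(\<Prod>j<N. norm z / 2) \<le> (\<Prod>j<N. norm (z - of_nat j))"
  proof (rule prod_mono)
    fix j assume "j \<in> {..<N}"
    then have "norm z / 2 \<le> norm z - norm (of_nat j :: complex)" using assms by simp
    also have "\<dots> \<le> norm (z - of_nat j)" by (rule norm_triangle_ineq2)
    finally show "0 \<le> norm z / 2 \<and> norm z / 2 \<le> norm (z - of_nat j)" by simp
  qed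
  then show ?thesis by (simp add: puncture_poly_def prod_norm)
qed

lemma puncture_poly_upper:
  assumes "norm z \<ge> real N"
  shows "norm (puncture_poly N z) \<le> (2 * norm z) ^ N"
proof -
  have "(\<Prod>j<N. norm (z - of_nat j)) \<le> (\<Prod>j<N. 2 * norm z)"
  proof (rule prod_mono)
    fix j assume "j \<in> {..<N}"
    then have "norm (z - of_nat j) \<le> 2 * norm z"
      using assms norm_triangle_ineq4[of z "of_nat j"] by simp
    then show "0 \<le> norm (z - of_nat j) \<and> norm (z - of_nat j) \<le> 2 * norm z" by simp
  qed
  then show ?thesis by (simp add: puncture_poly_def prod_norm)
qed

lemma basis_fun_in_Ap:
  assumes p: "0 < p" "p < 2" and i: "i + n = N" and n: "real n * p > 2"
  shows "basis_fun N i \<in> Ap p (- punctures N)"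
proof (rule Ap_punctured_plane_memI[OF p finite_punctures basis_fun_holomorphic _ _ _ n])
  show "basis_fun N i z = 0" if "z \<in> punctures N" for z using that by (simp add: basis_fun_def)
  show "\<exists>C. eventually (\<lambda>z. norm (basis_fun N i z) \<le> C / norm (z - a)) (at a)" if a: "a \<in> punctures N" for a
  proof -
    obtain q where q: "\<And>z. puncture_poly N z = (z - a) * q z" "q a \<noteq> 0" "isCont q a"
      using puncture_poly_split[OF a] by blast
    have "((\<lambda>z. norm (z ^ i / q z)) \<longlongrightarrow> norm (a ^ i / q a)) (at a)"
      using q by (intro tendsto_intros) (auto simp: isCont_def)
    then have "eventually (\<lambda>z. norm (z ^ i / q z) < norm (a ^ i / q a) + 1) (at a)"
      by (rule order_tendstoD) simp
    then have "eventually (\<lambda>z. norm (basis_fun N i z) \<le> (norm (a ^ i / q a) + 1) / norm (z - a)) (at a)"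
    proof eventually_elim
      case (elim z)
      have "norm (basis_fun N i z) \<le> norm (z ^ i / q z) / norm (z - a)"
        by (auto simp: basis_fun_def q(1) norm_divide norm_mult mult.commute)
      also have "\<dots> \<le> (norm (a ^ i / q a) + 1) / norm (z - a)"
        using elim by (intro divide_right_mono) auto
      finally show ?case .
    qed
    then show ?thesis by blast
  qed
  show "eventually (\<lambda>z. norm (basis_fun N i z) \<le> 2 ^ N / norm z ^ n) at_infinity"
    unfolding eventually_at_infinity
  proof (intro exI[of _ "2 * real N + 1"] allI impI)
    fix z :: complex assume z: "2 * real N + 1 \<le> norm z"
    then have z0: "norm z > 0" by linarith
    have "0 < (norm z / 2) ^ N" using z0 by simp
    also have "\<dots> \<le> norm (puncture_poly N z)" using z by (intro puncture_poly_lower) simp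
    finally have pos: "0 < norm (puncture_poly N z)" .
    have "norm (basis_fun N i z) \<le> norm z ^ i / norm (puncture_poly N z)"
      by (auto simp: basis_fun_def norm_divide norm_power)
    also have "\<dots> \<le> norm z ^ i / (norm z / 2) ^ N"
      using z z0 pos by (intro divide_left_mono puncture_poly_lower mult_pos_pos) simp_all
    also have "\<dots> = 2 ^ N / norm z ^ n"
      using z0 by (simp add: i[symmetric] power_divide power_add field_simps)
    finally show "norm (basis_fun N i z) \<le> 2 ^ N / norm z ^ n" .
  qed
qed

lemma basis_fun_relation:
  assumes rel: "\<And>z. (\<Sum>i\<in>{..<k}. \<gamma> i * basis_fun N i z) = 0" and i: "i \<in> {..<k}"
  shows "\<gamma> i = 0"
proof -
  have "(\<Sum>i<k. \<gamma> i * z ^ i) = 0" if z: "z \<in> - punctures N" for z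
  proof -
    have "(\<Sum>i<k. \<gamma> i * z ^ i) = puncture_poly N z * (\<Sum>i<k. \<gamma> i * basis_fun N i z)"
      using z by (auto simp: basis_fun_def sum_distrib_left puncture_poly_eq_0_iff intro!: sum.cong)
    then show ?thesis using rel by simp
  qed
  moreover obtain m where m: "k = Suc m" using i by (cases k) auto
  ultimately have "- punctures N \<subseteq> {z. (\<Sum>i\<le>m. \<gamma> i * z ^ i) = 0}"
    by (auto simp: lessThan_Suc_atMost)
  moreover have "infinite (- punctures N)"
    using finite_punctures[of N] infinite_UNIV_char_0 by (metis finite_Un sup_compl_top)
  ultimately have "\<not> (\<exists>i\<le>m. \<gamma> i \<noteq> 0)"
    using polyfun_finite_roots[of \<gamma> m] finite_subset by blast
  then show ?thesis using i m by auto
qed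

text \<open>Multiplying \<open>f\<close> by \<open>Q\<close> removes the singularities, which are at most simple poles. Since
  \<open>z\<^sup>m f(z)\<close> tends to \<open>0\<close> at infinity and \<open>Q\<close> has degree \<open>k + m\<close>, the product is an entire function
  of growth \<open>o(z\<^sup>k)\<close>, that is, a polynomial of degree less than \<open>k\<close>.\<close>

lemma Ap_punctured_plane_span:
  assumes p: "1 \<le> p" and mp: "real m * p \<le> 2" and f: "f \<in> Ap p (- punctures (k + m))"
  obtains c where "\<And>z. f z = (\<Sum>i<k. c i * basis_fun (k + m) i z)"
proof -
  define N where "N = k + m"
  note op = open_compl_punctures[of N]
  have hol: "f holomorphic_on - punctures N" and zero: "\<And>z. z \<in> punctures N \<Longrightarrow> f z = 0"
    and int: "integrable lborel (\<lambda>z. norm (f z) powr p)"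
    using f by (auto simp: Ap_iff[OF op] simp flip: N_def)
  have si: "set_integrable lborel (- punctures N) (\<lambda>z. norm (f z) powr p)"
    by (rule set_integrable_subset[of lborel UNIV])
      (use int op in \<open>simp_all add: set_integrable_def\<close>)
  have "((\<lambda>z. (z - a) * (f z * puncture_poly N z)) \<longlongrightarrow> 0) (at a)" if a: "a \<in> punctures N" for a
  proof -
    obtain q where q: "\<And>z. puncture_poly N z = (z - a) * q z" "q a \<noteq> 0" "isCont q a"
      using puncture_poly_split[OF a] by blast
    have "((\<lambda>z. (z - a) ^ 2 * f z) \<longlongrightarrow> 0) (at a)"
      using puncture_decay_power[OF p finite_punctures hol si, of 2] p by simp
    then have "((\<lambda>z. ((z - a) ^ 2 * f z) * q z) \<longlongrightarrow> 0 * q a) (at a)"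
      using q(3) by (intro tendsto_mult) (auto simp: isCont_def)
    then show ?thesis by (simp add: q(1) power2_eq_square mult_ac)
  qed
  then obtain h where h: "h holomorphic_on UNIV" "\<And>z. z \<notin> punctures N \<Longrightarrow> h z = f z * puncture_poly N z"
    using removable_singularities[OF finite_punctures, of "\<lambda>z. f z * puncture_poly N z" N] hol
    by (auto intro: holomorphic_intros)
  have "((\<lambda>z. h z / z ^ k) \<longlongrightarrow> 0) at_infinity"
  proof (rule Lim_null_comparison)
    have "((\<lambda>z. norm (z ^ m * f z)) \<longlongrightarrow> 0) at_infinity"
      using infinity_decay_power[OF p finite_punctures hol si mp] by (rule tendsto_norm_zero)
    then show "((\<lambda>z. 2 ^ N * norm (z ^ m * f z)) \<longlongrightarrow> 0) at_infinity"
      by (rule tendsto_mult_right_zero)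
    show "eventually (\<lambda>z. norm (h z / z ^ k) \<le> 2 ^ N * norm (z ^ m * f z)) at_infinity"
      unfolding eventually_at_infinity
    proof (intro exI[of _ "real N + 1"] allI impI)
      fix z :: complex assume z: "real N + 1 \<le> norm z"
      then have "z \<notin> punctures N" by (auto simp: punctures_def)
      then have "norm (h z / z ^ k) = norm (f z) * norm (puncture_poly N z) / norm z ^ k"
        using h(2) by (simp add: norm_divide norm_mult norm_power)
      also have "\<dots> \<le> norm (f z) * (2 * norm z) ^ N / norm z ^ k"
        using z by (intro divide_right_mono mult_left_mono puncture_poly_upper) auto
      also have "\<dots> = 2 ^ N * norm (z ^ m * f z)"
      proof -
        have "norm z > 0" using z by linarith
        then show ?thesis by (simp add: N_def norm_mult norm_power power_mult_distrib power_add field_simps)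
      qed
      finally show "norm (h z / z ^ k) \<le> 2 ^ N * norm (z ^ m * f z)" .
    qed
  qed
  then obtain c where c: "\<And>z. h z = (\<Sum>i<k. c i * z ^ i)"
    using entire_little_o_polynomial[OF h(1)] by blast
  have "f z = (\<Sum>i<k. c i * basis_fun N i z)" for z
  proof (cases "z \<in> punctures N")
    case False
    then have "f z = h z / puncture_poly N z"
      using h(2) by (simp add: puncture_poly_eq_0_iff)
    then show ?thesis using False by (simp add: c basis_fun_def sum_divide_distrib)
  qed (simp add: zero basis_fun_def)
  then show ?thesis using that by (simp add: N_def)
qed

text \<open>The number \<open>m\<close> is the largest integer with \<open>m p \<le> 2\<close>: Bergman functions decay faster than
  \<open>z\<^sup>-\<^sup>m\<close> at infinity, and \<open>z\<^sup>-\<^sup>m\<^sup>-\<^sup>1\<close> is in \<open>L\<^sup>p\<close> there.\<close>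

lemma dim_Ap_punctured_plane:
  assumes p: "1 \<le> p" and mp: "real m * p \<le> 2" "real (Suc m) * p > 2" and p2: "p < 2"
  shows "cfun.dim (Ap p (- punctures (k + m))) = k"
proof (rule cfun.dim_unique)
  let ?e = "basis_fun (k + m)" and ?V = "Ap p (- punctures (k + m))"
  have ind: "inj_on ?e {..<k}" "cfun.independent (?e ` {..<k})"
    by (rule family_independent; use basis_fun_relation in blast)+
  show "cfun.independent (?e ` {..<k})" by (rule ind)
  show "card (?e ` {..<k}) = k" using ind(1) by (simp add: card_image)
  have mem: "?e i \<in> ?V" if "i < k" for i
  proof (rule basis_fun_in_Ap)
    show "i + (k + m - i) = k + m" using that by simp
    have "real (Suc m) * p \<le> real (k + m - i) * p"
      using that p by (intro mult_right_mono) auto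
    then show "real (k + m - i) * p > 2" using mp by linarith
  qed (use p p2 in auto)
  then show "?e ` {..<k} \<subseteq> ?V" by auto
  show "?V \<subseteq> cfun.span (?e ` {..<k})"
  proof
    fix f assume "f \<in> ?V"
    then obtain c where c: "\<And>z. f z = (\<Sum>i<k. c i * ?e i z)"
      using Ap_punctured_plane_span[OF p mp(1)] by blast
    have "f = (\<Sum>i<k. cfun_scale (c i) (?e i))"
      by (simp add: fun_eq_iff sum_fun_apply c cfun_scale_def)
    also have "\<dots> \<in> cfun.span (?e ` {..<k})"
      by (intro cfun.span_sum cfun.span_scale cfun.span_base) auto
    finally show "f \<in> cfun.span (?e ` {..<k})" .
  qed
qed

theorem exists_domain_with_dim_Ap:
  assumes "1 \<le> p" "p < 2"
  shows "\<exists>\<Omega>. complex_domain \<Omega> \<and> cfun.dim (Ap p \<Omega>) = k"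
proof -
  \<comment> \<open>\<open>m = 2\<close> for \<open>p = 1\<close>, and \<open>m = 1\<close> for \<open>1 < p < 2\<close>.\<close>
  obtain m where m: "real m * p \<le> 2" "real (Suc m) * p > 2"
  proof (cases "p = 1")
    case True then show ?thesis using that[of 2] by simp
  next
    case False then show ?thesis using that[of 1] assms by simp
  qed
  have "complex_domain (- punctures (k + m))"
    using connected_open_delete_finite[OF open_UNIV connected_UNIV _ finite_punctures[of "k + m"]]
      open_compl_punctures[of "k + m"]
    by (simp add: complex_domain_def Compl_eq_Diff_UNIV)
  then show ?thesis using dim_Ap_punctured_plane[OF assms(1) m assms(2)] by blast
qed

section \<open>Bounded multipliers\<close>

lemma Ap_dominatedI:
  assumes "open \<Omega>" "f holomorphic_on \<Omega>" "\<And>z. z \<notin> \<Omega> \<Longrightarrow> f z = 0"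
    and h: "integrable lborel h" and le: "\<And>z. z \<in> \<Omega> \<Longrightarrow> norm (f z) powr p \<le> h z" "\<And>z. 0 \<le> h z"
  shows "f \<in> Ap p \<Omega>"
proof -
  have [measurable]: "f \<in> borel_measurable borel"
    using assms(1-3) by (rule holomorphic_extension_borel_measurable)
  have "norm (f z) powr p \<le> h z" for z
    using le[of z] assms(3)[of z] by (cases "z \<in> \<Omega>") auto
  then have "integrable lborel (\<lambda>z. norm (f z) powr p)"
    by (intro Bochner_Integration.integrable_bound[OF h]) (auto intro!: AE_I2 intro: order_trans[OF _ abs_ge_self])
  then show ?thesis using assms by (auto simp: Ap_iff)
qed

text \<open>All products \<open>g\<^sup>i f\<close> lie in the space. A linear relation between them makes \<open>g\<close> a root of a fixed
  nonzero polynomial wherever \<open>f \<noteq> 0\<close>, so that \<open>g\<close> is constant on a ball.\<close>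

lemma bounded_nonconstant_imp_infinite_dimensional:
  assumes p: "1 \<le> p" and dom: "complex_domain \<Omega>" and f: "f \<in> Ap p \<Omega>" "f \<noteq> 0"
    and g: "g holomorphic_on \<Omega>" and bd: "\<And>z. z \<in> \<Omega> \<Longrightarrow> norm (g z) \<le> M"
    and nc: "\<not> g constant_on \<Omega>"
  shows "infinite_dimensional (Ap p \<Omega>)"
proof (rule ccontr)
  assume fin: "\<not> infinite_dimensional (Ap p \<Omega>)"
  have op: "open \<Omega>" "connected \<Omega>" using dom by (auto simp: complex_domain_def)
  have hol: "f holomorphic_on \<Omega>" and zero: "\<And>z. z \<notin> \<Omega> \<Longrightarrow> f z = 0"
    and int: "integrable lborel (\<lambda>z. norm (f z) powr p)"
    using f(1) op by (auto simp: Ap_iff)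
  define u where "u = (\<lambda>(i::nat) z. g z ^ i * f z)"
  have "u i \<in> Ap p \<Omega>" for i
  proof (rule Ap_dominatedI[OF op(1)])
    show "u i holomorphic_on \<Omega>" unfolding u_def by (intro holomorphic_intros g hol)
    show "u i z = 0" if "z \<notin> \<Omega>" for z using zero[OF that] by (simp add: u_def)
    show "integrable lborel (\<lambda>z. (M ^ i) powr p * norm (f z) powr p)" using int by simp
    show "norm (u i z) powr p \<le> (M ^ i) powr p * norm (f z) powr p" if "z \<in> \<Omega>" for z
    proof -
      have "norm (u i z) powr p = (norm (g z) ^ i) powr p * norm (f z) powr p"
        by (simp add: u_def norm_mult norm_power powr_mult)
      also have "\<dots> \<le> (M ^ i) powr p * norm (f z) powr p"
        using p bd[OF that] by (intro mult_right_mono powr_mono2 power_mono) auto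
      finally show ?thesis .
    qed
  qed auto
  then obtain n \<gamma> i where rel: "i \<le> n" "\<gamma> i \<noteq> 0" "\<And>z. (\<Sum>j\<le>n. \<gamma> j * u j z) = 0"
    using finite_dimensional_relation[OF fin] by metis
  obtain z0 where z0: "f z0 \<noteq> 0" using f(2) by (auto simp: fun_eq_iff)
  then have "z0 \<in> \<Omega>" using zero by blast
  have "open {z \<in> \<Omega>. f z \<in> - {0}}"
    using holomorphic_on_imp_continuous_on[OF hol] op(1)
    by (intro continuous_open_preimage[unfolded vimage_def Int_def mem_Collect_eq]) auto
  then obtain r where r: "r > 0" "ball z0 r \<subseteq> {z \<in> \<Omega>. f z \<in> - {0}}"
    using z0 \<open>z0 \<in> \<Omega>\<close> by (auto elim!: openE[where x = z0])
  have "g ` ball z0 r \<subseteq> {x. (\<Sum>j\<le>n. \<gamma> j * x ^ j) = 0}"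
  proof clarify
    fix z assume z: "z \<in> ball z0 r"
    have "(\<Sum>j\<le>n. \<gamma> j * g z ^ j) * f z = (\<Sum>j\<le>n. \<gamma> j * u j z)"
      by (simp add: u_def sum_distrib_right mult.assoc)
    then show "(\<Sum>j\<le>n. \<gamma> j * g z ^ j) = 0" using rel(3)[of z] r(2) z by auto
  qed
  moreover have "finite {x. (\<Sum>j\<le>n. \<gamma> j * x ^ j) = 0}"
    using rel(1,2) polyfun_finite_roots[of \<gamma> n] by blast
  ultimately have "finite (g ` ball z0 r)" by (rule finite_subset)
  moreover have "connected (g ` ball z0 r)"
    using r(2) holomorphic_on_imp_continuous_on[OF g]
    by (intro connected_continuous_image) (auto intro: continuous_on_subset)
  ultimately obtain v where "g ` ball z0 r \<subseteq> {v}"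
    using connected_finite_iff_sing by (metis empty_subsetI subset_refl)
  then have v: "g z = v" if "z \<in> ball z0 r" for z
    using that by (metis imageI singletonD subsetD)
  have "g z = v" if "z \<in> \<Omega>" for z
    by (rule analytic_continuation_open[of "ball z0 r" \<Omega> g "\<lambda>_. v"])
      (use r op g v that in auto)
  then have "g constant_on \<Omega>" by (auto simp: constant_on_def)
  with nc show False by blast
qed

section \<open>The Cauchy transform of a compact set\<close>

text \<open>The Cauchy transform of Lebesgue measure on \<open>K\<close>. It is defined on the whole plane, also on \<open>K\<close>,
  because the kernel is locally integrable.\<close>

definition cauchy_transform :: "complex set \<Rightarrow> complex \<Rightarrow> complex" where
  "cauchy_transform K z = (LINT w:K|lborel. 1 / (w - z))"

lemma cauchy_transform_bounded:
  assumes K: "compact K"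
  obtains M where "\<And>z. norm (cauchy_transform K z) \<le> M"
proof -
  define C where "C = pi * (\<Sum>k. ((1::real) / 2 ^ Suc k) powr (-1) * (1 / 2 ^ k)\<^sup>2)"
  have iK: "integrable lborel (indicat_real K)"
    using K emeasure_compact_finite[OF K] by (intro integrable_real_indicator) (auto intro: borel_compact)
  have "norm (cauchy_transform K z) \<le> C + measure lborel K" for z
  proof -
    have near: "set_integrable lborel (ball z 1) (\<lambda>w. norm (w - z) powr (-1))"
      "(LINT w:ball z 1|lborel. norm (w - z) powr (-1)) \<le> C"
      using integrable_norm_powr_near[of 1 1 z] by (auto simp: C_def)
    have "norm (cauchy_transform K z) \<le> (LINT w|lborel. norm (indicat_real K w *\<^sub>R (1 / (w - z))))"
      unfolding cauchy_transform_def set_lebesgue_integral_def by (rule integral_norm_bound)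
    also have "\<dots> \<le> (LINT w|lborel. indicator (ball z 1) w *\<^sub>R norm (w - z) powr (-1) + indicat_real K w)"
    proof (rule integral_mono')
      show "integrable lborel (\<lambda>w. indicator (ball z 1) w *\<^sub>R norm (w - z) powr (-1) + indicat_real K w)"
        using near(1) iK by (intro Bochner_Integration.integrable_add) (simp_all add: set_integrable_def)
      fix w
      have inv: "norm (1 / (w - z)) = norm (w - z) powr (-1)"
        by (cases "w = z") (simp_all add: norm_divide powr_minus_divide)
      have le1: "norm (w - z) powr (-1) \<le> 1" if "w \<notin> ball z 1"
      proof -
        have "norm (w - z) \<ge> 1" using that by (simp add: dist_norm norm_minus_commute)
        then show ?thesis by (simp add: powr_minus_divide divide_le_eq_1)
      qed
      show "norm (indicat_real K w *\<^sub>R (1 / (w - z))) \<le> indicator (ball z 1) w *\<^sub>R norm (w - z) powr (-1) + indicat_real K w"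
        using inv le1 by (cases "w \<in> ball z 1"; cases "w \<in> K") simp_all
    qed simp
    also have "\<dots> = (LINT w:ball z 1|lborel. norm (w - z) powr (-1)) + (LINT w|lborel. indicat_real K w)"
      unfolding set_lebesgue_integral_def
      using near(1) iK by (intro Bochner_Integration.integral_add) (simp_all add: set_integrable_def)
    also have "\<dots> \<le> C + measure lborel K" using near(2) by simp
    finally show ?thesis .
  qed
  then show ?thesis using that by blast
qed

lemma cauchy_kernel_integrable:
  fixes K :: "complex set"
  assumes "compact K" "z \<notin> K"
  shows "set_integrable lborel K (\<lambda>w. 1 / (w - z))" "set_integrable lborel K (\<lambda>w. 1 / (w - z) ^ 2)"
proof -
  have "continuous_on K (\<lambda>w. 1 / (w - z) ^ n)" for n
    using assms(2) by (intro continuous_intros) auto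
  then have "set_integrable lborel K (\<lambda>w. 1 / (w - z) ^ n)" for n
    unfolding set_integrable_def by (rule borel_integrable_compact[OF assms(1)])
  from this[of 1] this[of 2]
  show "set_integrable lborel K (\<lambda>w. 1 / (w - z))" "set_integrable lborel K (\<lambda>w. 1 / (w - z) ^ 2)"
    by simp_all
qed

lemma norm_integral_compact_le:
  fixes f :: "complex \<Rightarrow> complex"
  assumes "compact K" "\<And>w. w \<in> K \<Longrightarrow> norm (f w) \<le> B"
  shows "norm (LINT w:K|lborel. f w) \<le> B * measure lborel K"
proof (cases "K = {}")
  case False
  then have B: "B \<ge> 0" using assms(2) norm_ge_zero order_trans by blast
  have iK: "integrable lborel (indicat_real K)"
    using emeasure_compact_finite[OF assms(1)] assms(1)
    by (intro integrable_real_indicator) (auto intro: borel_compact)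
  have "norm (LINT w:K|lborel. f w) \<le> (LINT w|lborel. norm (indicat_real K w *\<^sub>R f w))"
    unfolding set_lebesgue_integral_def by (rule integral_norm_bound)
  also have "\<dots> \<le> (LINT w|lborel. B * indicat_real K w)"
    using iK assms(2) B by (intro integral_mono') (auto split: split_indicator)
  finally show ?thesis by simp
qed (simp add: set_lebesgue_integral_def)

lemma cauchy_transform_holomorphic:
  assumes K: "compact K"
  shows "cauchy_transform K holomorphic_on - K"
proof (rule holomorphic_onI)
  fix z0 assume z0: "z0 \<in> - K"
  have "open (- K)" using K by (simp add: compact_imp_closed open_Compl)
  then obtain d where d: "d > 0" "ball z0 d \<subseteq> - K" using z0 by (rule openE)
  define D where "D = (LINT w:K|lborel. 1 / (w - z0) ^ 2)"
  define C where "C = 2 / d ^ 3 * measure lborel K"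
  have far: "norm (w - z0) \<ge> d" if "w \<in> K" for w
    using d that by (force simp: dist_norm norm_minus_commute)
  have est: "norm ((cauchy_transform K z - cauchy_transform K z0) / (z - z0) - D) \<le> C * norm (z - z0)"
    if z: "z \<noteq> z0" "dist z z0 < d / 2" for z
  proof -
    have far': "norm (w - z) \<ge> d / 2" if "w \<in> K" for w
      using far[OF that] z(2) norm_triangle_ineq[of "w - z" "z - z0"] by (simp add: dist_norm)
    have zK: "z \<notin> K" using far[of z] z(2) d(1) by (auto simp: dist_norm)
    have "cauchy_transform K z - cauchy_transform K z0 - (z - z0) * D
        = (LINT w:K|lborel. 1 / (w - z) - 1 / (w - z0) - (z - z0) * (1 / (w - z0) ^ 2))"
    proof -
      note a = cauchy_kernel_integrable(1)[OF K zK]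
      have b: "set_integrable lborel K (\<lambda>w. 1 / (w - z0))"
        using cauchy_kernel_integrable(1)[OF K] z0 by simp
      have c: "set_integrable lborel K (\<lambda>w. (z - z0) * (1 / (w - z0) ^ 2))"
        using cauchy_kernel_integrable(2)[OF K] z0 by (intro set_integrable_mult_right) simp
      show ?thesis
        unfolding cauchy_transform_def D_def
        by (simp only: set_integral_diff(2)[OF set_integral_diff(1)[OF a b] c] set_integral_diff(2)[OF a b] set_integral_mult_right)
    qed
    also have "\<dots> = (LINT w:K|lborel. (z - z0) ^ 2 / ((w - z) * (w - z0) ^ 2))"
    proof (intro set_lebesgue_integral_cong allI impI)
      fix w assume w: "w \<in> K"
      have "w \<noteq> z" "w \<noteq> z0" using w zK z0 by auto
      then show "1 / (w - z) - 1 / (w - z0) - (z - z0) * (1 / (w - z0) ^ 2) = (z - z0) ^ 2 / ((w - z) * (w - z0) ^ 2)"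
        by (simp add: divide_simps) (simp add: algebra_simps power2_eq_square)
    qed (use K in \<open>auto intro: borel_compact\<close>)
    also have "norm \<dots> \<le> (norm (z - z0) ^ 2 * (2 / d ^ 3)) * measure lborel K"
    proof (rule norm_integral_compact_le[OF K])
      fix w assume w: "w \<in> K"
      have "norm (z - z0) ^ 2 / (norm (w - z) * norm (w - z0) ^ 2) \<le> norm (z - z0) ^ 2 / (d / 2 * d ^ 2)"
        using far[OF w] far'[OF w] d(1)
        by (intro divide_left_mono mult_mono power_mono mult_pos_pos) (auto intro!: zero_less_power)
      then show "norm ((z - z0) ^ 2 / ((w - z) * (w - z0) ^ 2)) \<le> norm (z - z0) ^ 2 * (2 / d ^ 3)"
        by (simp add: norm_divide norm_mult norm_power power3_eq_cube power2_eq_square mult_ac)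
    qed
    finally have "norm (cauchy_transform K z - cauchy_transform K z0 - (z - z0) * D) \<le> C * norm (z - z0) * norm (z - z0)"
      by (simp add: C_def power2_eq_square mult_ac)
    moreover have "(cauchy_transform K z - cauchy_transform K z0) / (z - z0) - D
        = (cauchy_transform K z - cauchy_transform K z0 - (z - z0) * D) / (z - z0)"
      using z(1) by (simp add: diff_divide_distrib)
    ultimately show ?thesis using z(1) by (simp add: norm_divide divide_le_eq)
  qed
  have "((\<lambda>z. (cauchy_transform K z - cauchy_transform K z0) / (z - z0)) \<longlongrightarrow> D) (at z0)"
  proof (rule LIM_zero_cancel, rule Lim_null_comparison)
    show "eventually (\<lambda>z. norm ((cauchy_transform K z - cauchy_transform K z0) / (z - z0) - D) \<le> C * norm (z - z0)) (at z0)"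
      using est d(1) unfolding eventually_at by (intro exI[of _ "d / 2"]) auto
    show "((\<lambda>z. C * norm (z - z0)) \<longlongrightarrow> 0) (at z0)"
      by (auto intro!: tendsto_eq_intros)
  qed
  then have "(cauchy_transform K has_field_derivative D) (at z0)"
    by (simp add: has_field_derivative_iff)
  then show "cauchy_transform K field_differentiable at z0 within - K"
    by (auto simp: field_differentiable_def intro: has_field_derivative_at_within)
qed

text \<open>Far to the left of \<open>K\<close> the transform has positive real part, and it tends to \<open>0\<close> there. Density of
  \<open>\<Omega>\<close> is needed because \<open>\<Omega>\<close> could otherwise lie in a bounded component of the complement of \<open>K\<close>, where
  the transform may be constant.\<close>

lemma cauchy_transform_not_constant:
  assumes K: "compact K" and pos: "measure lborel K > 0"
    and \<Omega>: "\<Omega> \<subseteq> - K" "closure \<Omega> = UNIV"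
  shows "\<not> cauchy_transform K constant_on \<Omega>"
proof
  assume "cauchy_transform K constant_on \<Omega>"
  then obtain v where v: "\<And>z. z \<in> \<Omega> \<Longrightarrow> cauchy_transform K z = v" by (auto simp: constant_on_def)
  have opK: "open (- K)" using K by (simp add: compact_imp_closed open_Compl)
  have v': "cauchy_transform K z = v" if z: "z \<in> - K" for z
  proof -
    have "isCont (cauchy_transform K) z"
      using holomorphic_on_imp_continuous_on[OF cauchy_transform_holomorphic[OF K]] opK z
      by (simp add: continuous_on_eq_continuous_at)
    moreover obtain x where x: "\<And>n. x n \<in> \<Omega>" "x \<longlonglongrightarrow> z"
      using \<Omega>(2) closure_sequential[of z \<Omega>] by auto
    ultimately have "(\<lambda>n. cauchy_transform K (x n)) \<longlonglongrightarrow> cauchy_transform K z"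
      by (metis isCont_tendsto_compose)
    then have "(\<lambda>n::nat. v) \<longlonglongrightarrow> cauchy_transform K z" using x(1) v by simp
    then show ?thesis by (simp add: LIMSEQ_const_iff)
  qed
  obtain R where R: "R > 0" "K \<subseteq> ball 0 R"
    using bounded_subset_ballD[OF compact_imp_bounded[OF K], of 0] by blast
  \<comment> \<open>Letting \<open>t\<close> grow shows that the constant value would be \<open>0\<close>.\<close>
  have small: "norm v \<le> measure lborel K / t" if t: "t > 0" for t
  proof -
    define z where "z = - complex_of_real (R + t)"
    have zn: "norm z = R + t" using R(1) t by (simp add: z_def del: of_real_add)
    then have "z \<in> - K" using R(2) t by auto
    have "norm (cauchy_transform K z) \<le> (1 / t) * measure lborel K"
      unfolding cauchy_transform_def
    proof (rule norm_integral_compact_le[OF K])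
      fix w assume "w \<in> K"
      then have "norm w < R" using R(2) by auto
      then have "t \<le> norm (w - z)"
        using zn norm_triangle_ineq2[of z w] by (simp add: norm_minus_commute)
      then show "norm (1 / (w - z)) \<le> 1 / t"
        using t by (simp add: norm_divide frac_le)
    qed
    then show ?thesis using v'[OF \<open>z \<in> - K\<close>] by simp
  qed
  have "norm v \<le> 0"
  proof (rule field_le_epsilon)
    fix e :: real assume "e > 0"
    then show "norm v \<le> 0 + e" using small[of "measure lborel K / e"] pos by simp
  qed
  then have v0: "v = 0" by simp
  \<comment> \<open>At a point to the left of \<open>K\<close> the kernel has real part bounded below by a positive constant.\<close>
  define z where "z = - complex_of_real (2 * R)"
  have zn: "norm z = 2 * R" using R(1) by (simp add: z_def)
  then have zK: "z \<in> - K" using R by auto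
  have i: "set_integrable lborel K (\<lambda>w. 1 / (w - z))" using cauchy_kernel_integrable[OF K] zK by auto
  have "Re (cauchy_transform K z) = (LINT w:K|lborel. Re (1 / (w - z)))"
    using i unfolding cauchy_transform_def set_lebesgue_integral_def set_integrable_def
    by (subst integral_Re[symmetric]) auto
  also have "\<dots> \<ge> (LINT w:K|lborel. R / (3 * R) ^ 2)"
  proof (rule set_integral_mono)
    show "set_integrable lborel K (\<lambda>w. R / (3 * R) ^ 2)"
      unfolding set_integrable_def using K by (intro borel_integrable_compact) auto
    show "set_integrable lborel K (\<lambda>w. Re (1 / (w - z)))"
      using integrable_Re[OF i[unfolded set_integrable_def]] by (simp add: set_integrable_def)
    fix w assume "w \<in> K"
    then have w: "norm w < R" using R(2) by auto
    have re: "Re (w - z) \<ge> R" using abs_Re_le_cmod[of w] w by (simp add: z_def)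
    have n: "norm (w - z) \<le> 3 * R" using norm_triangle_ineq4[of w z] w zn by simp
    have "norm (w - z) > 0" using re R(1) abs_Re_le_cmod[of "w - z"] by linarith
    then have "R / (3 * R) ^ 2 \<le> Re (w - z) / norm (w - z) ^ 2"
      using re n R(1) by (intro frac_le power_mono) auto
    then show "R / (3 * R) ^ 2 \<le> Re (1 / (w - z))" by (simp add: Re_divide cmod_power2)
  qed
  also have "(LINT w:K|lborel. R / (3 * R) ^ 2) = R / (3 * R) ^ 2 * measure lborel K"
    unfolding set_lebesgue_integral_def by simp
  finally have "Re (cauchy_transform K z) > 0"
    using R(1) pos by (auto intro: less_le_trans[rotated])
  then show False using v'[OF zK] v0 by simp
qed

section \<open>Domains with null complement\<close>

text \<open>The difference quotient of \<open>f\<close> at \<open>b\<close>, with its removable singularity filled in, extended by \<open>0\<close>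
  off \<open>\<Omega>\<close>.\<close>

definition diff_quot :: "complex set \<Rightarrow> (complex \<Rightarrow> complex) \<Rightarrow> complex \<Rightarrow> complex \<Rightarrow> complex" where
  "diff_quot \<Omega> f b z = (if z \<in> \<Omega> then if z = b then deriv f b else (f z - f b) / (z - b) else 0)"

lemma diff_quot_holomorphic:
  assumes "open \<Omega>" "f holomorphic_on \<Omega>"
  shows "diff_quot \<Omega> f b holomorphic_on \<Omega>"
  by (rule holomorphic_transform[OF pole_lemma_open[OF assms(2,1), of b]]) (auto simp: diff_quot_def)

text \<open>If \<open>\<Omega>\<close> contains a neighbourhood of infinity, a single difference quotient behaves there
  like \<open>- f b / z\<close> plus an \<open>L\<^sup>p\<close> function, and \<open>1 / z\<close> is not in \<open>L\<^sup>p\<close> for \<open>p = 2\<close>. In the combination of two quotients the terms of order \<open>1 / z\<close> cancel.\<close>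

lemma diff_quot_combination_in_Ap:
  assumes p: "2 \<le> p" and op: "open \<Omega>" and f: "f \<in> Ap p \<Omega>" and b: "b \<in> \<Omega>" and c: "c \<in> \<Omega>"
  shows "(\<lambda>z. f c * diff_quot \<Omega> f b z - f b * diff_quot \<Omega> f c z) \<in> Ap p \<Omega>"
proof -
  define u where "u = (\<lambda>z. f c * diff_quot \<Omega> f b z - f b * diff_quot \<Omega> f c z)"
  have p1: "1 \<le> p" using p by simp
  have hol: "f holomorphic_on \<Omega>" and int: "integrable lborel (\<lambda>z. norm (f z) powr p)"
    using f op by (auto simp: Ap_iff)
  have uhol: "u holomorphic_on \<Omega>"
    unfolding u_def by (intro holomorphic_intros diff_quot_holomorphic op hol)
  have uzero: "u z = 0" if "z \<notin> \<Omega>" for z using that by (simp add: u_def diff_quot_def)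
  obtain r1 where r1: "r1 > 0" "cball b r1 \<subseteq> \<Omega>" using op b open_contains_cball by blast
  obtain r2 where r2: "r2 > 0" "cball c r2 \<subseteq> \<Omega>" using op c open_contains_cball by blast
  define K where "K = cball b r1 \<union> cball c r2"
  have K: "compact K" "K \<subseteq> \<Omega>" using r1 r2 by (auto simp: K_def)
  \<comment> \<open>Off \<open>K\<close>, \<open>A\<close> bounds the factor of \<open>f\<close> in the combination, and \<open>B\<close> is the coefficient of
      the remaining term \<open>1 / ((z - b) (z - c))\<close>.\<close>
  define A where "A = norm (f c) / r1 + norm (f b) / r2"
  define B where "B = norm (f b * f c * (b - c))"
  have AB: "A \<ge> 0" "B \<ge> 0" using r1 r2 by (simp_all add: A_def B_def)
  define h where "h = (\<lambda>z. indicator K z *\<^sub>R norm (u z) powr p +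
     2 powr p * (A powr p * norm (f z) powr p + 2 powr p * B powr p *
       (indicator (- ball b r1) z *\<^sub>R norm (z - b) powr (- (2 * p)) + indicator (- ball c r2) z *\<^sub>R norm (z - c) powr (- (2 * p)))))"
  have "continuous_on K (\<lambda>z. norm (u z) powr p)"
    using p holomorphic_on_imp_continuous_on[OF uhol] K
    by (intro continuous_on_powr' continuous_intros) (auto intro: continuous_on_subset)
  then have i1: "integrable lborel (\<lambda>z. indicator K z *\<^sub>R norm (u z) powr p)"
    by (rule borel_integrable_compact[OF K(1)])
  have i2: "integrable lborel (\<lambda>z. indicator (- ball b r1) z *\<^sub>R norm (z - b) powr (- (2 * p)))"
    "integrable lborel (\<lambda>z. indicator (- ball c r2) z *\<^sub>R norm (z - c) powr (- (2 * p)))"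
    using integrable_norm_powr_far[of "2 * p" r1 b] integrable_norm_powr_far[of "2 * p" r2 c] p r1 r2
    unfolding set_integrable_def by auto
  have hint: "integrable lborel h"
    unfolding h_def
    by (intro Bochner_Integration.integrable_add integrable_mult_right i1 i2 int)
  have h0: "0 \<le> h z" for z
    unfolding h_def by (intro add_nonneg_nonneg mult_nonneg_nonneg) (auto simp: indicator_def)
  have le: "norm (u z) powr p \<le> h z" if z: "z \<in> \<Omega>" for z
  proof (cases "z \<in> K")
    case True
    have "0 \<le> 2 powr p * (A powr p * norm (f z) powr p + 2 powr p * B powr p *
       (indicator (- ball b r1) z *\<^sub>R norm (z - b) powr (- (2 * p)) + indicator (- ball c r2) z *\<^sub>R norm (z - c) powr (- (2 * p))))"
      by (intro add_nonneg_nonneg mult_nonneg_nonneg) (auto simp: indicator_def)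
    then show ?thesis using True by (simp add: h_def)
  next
    case False
    define x y where "x = norm (z - b)" and "y = norm (z - c)"
    have xy: "x > r1" "y > r2" using False by (auto simp: K_def x_def y_def dist_norm norm_minus_commute)
    then have x0: "x > 0" "y > 0" using r1 r2 by auto
    then have ne: "z \<noteq> b" "z \<noteq> c" by (auto simp: x_def y_def)
    have "u z = f z * (f c / (z - b) - f b / (z - c)) + (- (f b * f c * (b - c))) / ((z - b) * (z - c))"
      using z ne by (simp add: u_def diff_quot_def divide_simps) (simp add: algebra_simps)
    then have n1: "norm (u z) \<le> norm (f z) * norm (f c / (z - b) - f b / (z - c)) + B / (x * y)"
      using norm_triangle_ineq[of "f z * (f c / (z - b) - f b / (z - c))"] unfolding B_def x_def y_def
      by (metis (no_types, lifting) norm_divide norm_minus_cancel norm_mult)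
    have "norm (f c / (z - b) - f b / (z - c)) \<le> norm (f c) / x + norm (f b) / y"
      using norm_triangle_ineq4[of "f c / (z - b)" "f b / (z - c)"] by (simp add: x_def y_def norm_divide)
    also have "\<dots> \<le> A"
      unfolding A_def using xy r1 r2 by (intro add_mono divide_left_mono mult_pos_pos) auto
    finally have n2: "norm (f z) * norm (f c / (z - b) - f b / (z - c)) \<le> norm (f z) * A"
      by (intro mult_left_mono) auto
    have n3: "B / (x * y) \<le> B * (1 / x ^ 2 + 1 / y ^ 2)"
    proof -
      have "0 \<le> (1 / x - 1 / y) ^ 2" by simp
      also have "\<dots> = 1 / x ^ 2 + 1 / y ^ 2 - 2 / (x * y)"
        using x0 by (simp add: power2_eq_square field_simps)
      finally have "1 / (x * y) \<le> 1 / x ^ 2 + 1 / y ^ 2"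
        using x0 zero_less_mult_iff[of x y] by (smt (verit, best) add_divide_distrib divide_nonneg_pos one_add_one)
      then have "B * (1 / (x * y)) \<le> B * (1 / x ^ 2 + 1 / y ^ 2)" using AB by (intro mult_left_mono)
      then show ?thesis by simp
    qed
    have "norm (u z) \<le> A * norm (f z) + B * (1 / x ^ 2 + 1 / y ^ 2)"
      using n1 n2 n3 by (simp only: mult.commute[of A])
    then have "norm (u z) powr p \<le> (A * norm (f z) + B * (1 / x ^ 2 + 1 / y ^ 2)) powr p"
      using p by (intro powr_mono2) auto
    also have "\<dots> \<le> 2 powr p * ((A * norm (f z)) powr p + (B * (1 / x ^ 2 + 1 / y ^ 2)) powr p)"
      using p1 AB by (intro powr_add_le) auto
    also have "(A * norm (f z)) powr p = A powr p * norm (f z) powr p" by (rule powr_mult)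
    also have "(B * (1 / x ^ 2 + 1 / y ^ 2)) powr p = B powr p * (1 / x ^ 2 + 1 / y ^ 2) powr p"
      by (rule powr_mult)
    also have "2 powr p * (A powr p * norm (f z) powr p + B powr p * (1 / x ^ 2 + 1 / y ^ 2) powr p)
       \<le> 2 powr p * (A powr p * norm (f z) powr p + B powr p * (2 powr p * ((1 / x ^ 2) powr p + (1 / y ^ 2) powr p)))"
      using p1 by (intro mult_left_mono add_left_mono powr_add_le) auto
    also have "\<dots> = h z"
    proof -
      have sq: "(1 / t ^ 2) powr p = t powr (- (2 * p))" if "t > 0" for t :: real
      proof -
        have "t ^ 2 = t powr 2" using that by simp
        then show ?thesis using that by (simp only: powr_divide powr_powr powr_minus_divide powr_one_eq_one)
      qed
      have "z \<notin> ball b r1" "z \<notin> ball c r2" using False by (auto simp: K_def)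
      then show ?thesis
        using False sq[OF x0(1)] sq[OF x0(2)] by (simp add: h_def x_def y_def)
    qed
    finally show ?thesis .
  qed
  have "u \<in> Ap p \<Omega>" by (rule Ap_dominatedI[OF op uhol uzero hint le h0])
  then show ?thesis by (simp add: u_def)
qed

text \<open>A Bergman function that is a quotient with finitely many singularities extends to a finitely
  punctured plane, and the extension keeps its \<open>L\<^sup>p\<close> norm because the complement of \<open>\<Omega>\<close> is null.\<close>

lemma rational_in_Ap_eq_0:
  assumes p: "2 \<le> p" and op: "open \<Omega>" and null: "- \<Omega> \<in> null_sets lborel" and f: "f \<in> Ap p \<Omega>"
    and R: "R1 holomorphic_on - T" "R2 holomorphic_on - T" and T: "finite T"
    and nz: "\<And>z. z \<notin> T \<Longrightarrow> R2 z \<noteq> 0" and eq: "\<And>z. z \<in> \<Omega> \<Longrightarrow> z \<notin> T \<Longrightarrow> f z * R2 z = R1 z"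
  shows "f = 0"
proof -
  have hol: "f holomorphic_on \<Omega>" and zero: "\<And>z. z \<notin> \<Omega> \<Longrightarrow> f z = 0"
    and int: "integrable lborel (\<lambda>z. norm (f z) powr p)"
    using f op by (auto simp: Ap_iff)
  have opT: "open (- T)" using T by (simp add: finite_imp_closed open_Compl)
  define g where "g = (\<lambda>z. if z \<in> - T then R1 z / R2 z else 0)"
  have "(\<lambda>z. R1 z / R2 z) holomorphic_on - T" using R nz by (intro holomorphic_intros) auto
  then have ghol: "g holomorphic_on - T" by (rule holomorphic_transform) (simp add: g_def)
  have [measurable]: "g \<in> borel_measurable borel"
    using opT ghol by (rule holomorphic_extension_borel_measurable) (simp add: g_def)
  have gf: "g z = f z" if "z \<in> \<Omega>" "z \<notin> T" for z
    using eq[OF that] nz[OF that(2)] that(2) by (simp add: g_def field_simps)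
  have "AE z in lborel. z \<notin> - \<Omega>" using null by (rule AE_not_in)
  then have ae: "AE z in lborel. indicator (- T) z *\<^sub>R norm (f z) powr p = indicator (- T) z *\<^sub>R norm (g z) powr p"
    by eventually_elim (use gf in \<open>auto split: split_indicator\<close>)
  have "set_integrable lborel (- T) (\<lambda>z. norm (f z) powr p)"
    by (rule set_integrable_subset[of lborel UNIV])
      (use int opT in \<open>simp_all add: set_integrable_def\<close>)
  then have "set_integrable lborel (- T) (\<lambda>z. norm (g z) powr p)"
    unfolding set_integrable_def
  proof (rule integrable_cong_AE_imp)
    show "(\<lambda>z. indicator (- T) z *\<^sub>R norm (g z) powr p) \<in> borel_measurable lborel"
    proof -
      have [measurable]: "- T \<in> sets borel" using opT by simp
      have "(\<lambda>z. norm (g z) powr p) \<in> borel_measurable borel" by measurable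
      then show ?thesis by (intro borel_measurable_scaleR borel_measurable_indicator) auto
    qed
  qed (use ae in \<open>auto elim!: eventually_mono\<close>)
  then have g0: "g z = 0" if "z \<notin> T" for z
    using finitely_punctured_plane_trivial[OF p T ghol _ that] by blast
  have "f z = 0" for z
  proof (cases "z \<in> \<Omega>")
    case z: True
    have lim: "(f \<longlongrightarrow> f z) (at z)"
      using holomorphic_on_imp_continuous_on[OF hol] op z
      by (simp add: continuous_on_eq_continuous_at isCont_def)
    have "open (\<Omega> - (T - {z}))" using op T by (intro open_Diff finite_imp_closed) auto
    then have "eventually (\<lambda>w. w \<in> \<Omega> - (T - {z}) - {z}) (at z)"
      using z by (intro eventually_at_in_open) auto
    then have "eventually (\<lambda>w. f w = 0) (at z)"
      by eventually_elim (use gf g0 in auto)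
    then have "(f \<longlongrightarrow> 0) (at z)" by (rule tendsto_eventually)
    then show ?thesis using lim by (intro tendsto_unique[of "at z" f]) auto
  qed (use zero in auto)
  then show ?thesis by (simp add: fun_eq_iff)
qed

text \<open>In finite dimension the combinations of difference quotients of \<open>f\<close> at the points \<open>b j\<close> and \<open>c\<close>
  satisfy a linear relation. It reads \<open>f R\<^sub>2 = R\<^sub>1\<close> with rational \<open>R\<^sub>1\<close> and \<open>R\<^sub>2\<close>, and \<open>R\<^sub>2\<close> is not the
  zero function because it has a pole at \<open>b k\<close>. So \<open>f\<close> is rational, hence zero.\<close>

lemma null_complement_imp_infinite_dimensional:
  assumes p: "2 \<le> p" and op: "open \<Omega>" and null: "- \<Omega> \<in> null_sets lborel"
    and f: "f \<in> Ap p \<Omega>" "f \<noteq> 0"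
  shows "infinite_dimensional (Ap p \<Omega>)"
proof (rule ccontr)
  assume fin: "\<not> infinite_dimensional (Ap p \<Omega>)"
  have hol: "f holomorphic_on \<Omega>" and zero: "\<And>z. z \<notin> \<Omega> \<Longrightarrow> f z = 0"
    using f op by (auto simp: Ap_iff)
  define U where "U = {z \<in> \<Omega>. f z \<in> - {0}}"
  have "open U"
    unfolding U_def using holomorphic_on_imp_continuous_on[OF hol] op
    by (intro continuous_open_preimage[unfolded vimage_def Int_def mem_Collect_eq]) auto
  moreover have "U \<noteq> {}" using f(2) zero by (auto simp: U_def fun_eq_iff)
  ultimately have "infinite U" using finite_imp_not_open by blast
  \<comment> \<open>All \<open>b j\<close> and \<open>c\<close> are distinct points at which \<open>f\<close> does not vanish.\<close>
  then obtain s :: "nat \<Rightarrow> complex" where s: "inj s" "range s \<subseteq> U"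
    using infinite_countable_subset by blast
  define c b where "c = s 0" and "b = (\<lambda>i. s (Suc i))"
  have bc: "b i \<in> \<Omega>" "f (b i) \<noteq> 0" "b i \<noteq> c" "c \<in> \<Omega>" "f c \<noteq> 0" for i
    using s injD[OF s(1), of "Suc i" 0] by (auto simp: U_def b_def c_def)
  have binj: "b i = b j \<longleftrightarrow> i = j" for i j using s(1) by (auto simp: b_def inj_eq)
  define u where "u = (\<lambda>j z. f c * diff_quot \<Omega> f (b j) z - f (b j) * diff_quot \<Omega> f c z)"
  have u: "u j \<in> Ap p \<Omega>" for j
    unfolding u_def using bc by (intro diff_quot_combination_in_Ap p op f)
  obtain n \<gamma> k where rel: "k \<le> n" "\<gamma> k \<noteq> 0" "\<And>z. (\<Sum>j\<le>n. \<gamma> j * u j z) = 0"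
    by (rule finite_dimensional_relation[of "Ap p \<Omega>" u, OF fin u]) (rule that)
  define R2 where "R2 = (\<lambda>z. \<Sum>j\<le>n. \<gamma> j * (f c / (z - b j) - f (b j) / (z - c)))"
  define R1 where "R1 = (\<lambda>z. \<Sum>j\<le>n. \<gamma> j * (f c * f (b j) / (z - b j) - f (b j) * f c / (z - c)))"
  define T0 where "T0 = insert c (b ` {..n})"
  have eq: "f z * R2 z = R1 z" if z: "z \<in> \<Omega>" "z \<notin> T0" for z
  proof -
    have "f z * R2 z - R1 z = (\<Sum>j\<le>n. \<gamma> j * (f c * diff_quot \<Omega> f (b j) z - f (b j) * diff_quot \<Omega> f c z))"
      unfolding R1_def R2_def sum_distrib_left sum_subtractf[symmetric]
    proof (rule sum.cong)
      fix j assume "j \<in> {..n}"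
      then have "z \<noteq> b j" "z \<noteq> c" using z by (auto simp: T0_def)
      then show "f z * (\<gamma> j * (f c / (z - b j) - f (b j) / (z - c))) - \<gamma> j * (f c * f (b j) / (z - b j) - f (b j) * f c / (z - c))
         = \<gamma> j * (f c * diff_quot \<Omega> f (b j) z - f (b j) * diff_quot \<Omega> f c z)"
      proof -
        have "F * (g * (C * X - B * Y)) - g * (C * B * X - B * C * Y) = g * (C * ((F - B) * X) - B * ((F - C) * Y))"
          for F g C B X Y :: complex by (simp add: algebra_simps)
        from this[of "f z" "\<gamma> j" "f c" "inverse (z - b j)" "f (b j)" "inverse (z - c)"]
        show ?thesis using z(1) \<open>z \<noteq> b j\<close> \<open>z \<noteq> c\<close> by (simp only: diff_quot_def divide_inverse if_True if_False)
      qed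
    qed simp
    then show ?thesis using rel(3)[of z] by (simp add: u_def)
  qed
  \<comment> \<open>\<open>P\<close> is the numerator of \<open>R2\<close> over the common denominator \<open>W z * (z - c)\<close>.\<close>
  define W where "W = (\<Prod>l\<le>n. [:- b l, 1:])"
  define q where "q = (\<lambda>j. \<Prod>l\<in>{..n} - {j}. [:- b l, 1:])"
  define P where "P = (\<Sum>j\<le>n. smult (\<gamma> j) (smult (f c) (q j * [:- c, 1:]) - smult (f (b j)) W))"
  have polyW: "poly W z = (\<Prod>l\<le>n. z - b l)" for z by (simp add: W_def poly_prod)
  have polyq: "poly (q j) z = (\<Prod>l\<in>{..n} - {j}. z - b l)" for j z by (simp add: q_def poly_prod)
  have Wq: "poly W z = (z - b j) * poly (q j) z" if "j \<le> n" for j z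
    unfolding polyW polyq using that by (simp add: prod.remove[of "{..n}" j])
  have polyP: "poly P z = (\<Sum>j\<le>n. \<gamma> j * (f c * (poly (q j) z * (z - c)) - f (b j) * poly W z))" for z
    unfolding P_def poly_sum by (intro sum.cong refl) (simp add: algebra_simps)
  have R2P: "R2 z * (poly W z * (z - c)) = poly P z" if "z \<notin> T0" for z
    unfolding R2_def polyP sum_distrib_right
  proof (rule sum.cong)
    fix j assume "j \<in> {..n}"
    then have "z \<noteq> b j" "z \<noteq> c" "j \<le> n" using that by (auto simp: T0_def)
    then show "\<gamma> j * (f c / (z - b j) - f (b j) / (z - c)) * (poly W z * (z - c))
       = \<gamma> j * (f c * (poly (q j) z * (z - c)) - f (b j) * poly W z)"
    proof -
      have "g * (C / X - B / Y) * (X * Q * Y) = g * (C * (Q * Y) - B * (X * Q))"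
        if "X \<noteq> 0" "Y \<noteq> 0" for g C B X Y Q :: complex
        using that by (simp add: field_simps)
      from this[of "z - b j" "z - c" "\<gamma> j" "f c" "f (b j)" "poly (q j) z"]
      show ?thesis using \<open>z \<noteq> b j\<close> \<open>z \<noteq> c\<close> by (simp only: Wq[OF \<open>j \<le> n\<close>] right_minus_eq not_False_eq_True simp_thms)
    qed
  qed simp
  \<comment> \<open>At \<open>b k\<close> only the summand \<open>j = k\<close> of \<open>P\<close> survives.\<close>
  have "poly P (b k) = \<gamma> k * f c * (poly (q k) (b k) * (b k - c))"
  proof -
    have "poly W (b k) = 0" using rel(1) by (simp add: Wq[of k])
    then have "poly P (b k) = (\<Sum>j\<le>n. \<gamma> j * (f c * (poly (q j) (b k) * (b k - c))))"
      by (simp add: polyP)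
    also have "\<dots> = (\<Sum>j\<in>{k}. \<gamma> j * (f c * (poly (q j) (b k) * (b k - c))))"
    proof (rule sum.mono_neutral_right)
      show "\<forall>j\<in>{..n} - {k}. \<gamma> j * (f c * (poly (q j) (b k) * (b k - c))) = 0"
        using rel(1) by (auto simp: polyq)
    qed (use rel(1) in auto)
    finally show ?thesis by simp
  qed
  moreover have "poly (q k) (b k) \<noteq> 0" by (auto simp: polyq binj)
  ultimately have "P \<noteq> 0" using rel(2) bc by auto
  define T where "T = T0 \<union> {z. poly P z = 0}"
  have T: "finite T" using poly_roots_finite[OF \<open>P \<noteq> 0\<close>] by (simp add: T_def T0_def)
  have "R2 z \<noteq> 0" if "z \<notin> T" for z using R2P[of z] that by (auto simp: T_def)
  moreover have "R1 holomorphic_on - T" "R2 holomorphic_on - T"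
    unfolding R1_def R2_def by (auto intro!: holomorphic_intros simp: T_def T0_def)
  ultimately have "f = 0"
    using eq by (intro rational_in_Ap_eq_0[OF p op null f(1) _ _ T, of R1 R2]) (auto simp: T_def)
  with f(2) show False by blast
qed

section \<open>The dichotomy\<close>

text \<open>If the complement has interior, or has empty interior but positive measure, there is a bounded
  nonconstant holomorphic function on \<open>\<Omega>\<close>; otherwise the complement is null.\<close>

lemma Ap_infinite_dimensional:
  assumes p: "2 \<le> p" and dom: "complex_domain \<Omega>" and f: "f \<in> Ap p \<Omega>" "f \<noteq> 0"
  shows "infinite_dimensional (Ap p \<Omega>)"
proof -
  have p1: "1 \<le> p" using p by simp
  have op: "open \<Omega>" using dom by (simp add: complex_domain_def)
  have "\<Omega> \<noteq> {}" using f op by (auto simp: Ap_iff fun_eq_iff)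
  consider "interior (- \<Omega>) \<noteq> {}" | "interior (- \<Omega>) = {}" "- \<Omega> \<notin> null_sets lborel" | "- \<Omega> \<in> null_sets lborel"
    by blast
  then show ?thesis
  proof cases
    case 1
    then obtain b r where b: "r > 0" "ball b r \<subseteq> - \<Omega>" by (meson all_not_in_conv mem_interior)
    have far: "norm (z - b) \<ge> r" if "z \<in> \<Omega>" for z
      using b(2) that by (force simp: dist_norm norm_minus_commute)
    show ?thesis
    proof (rule bounded_nonconstant_imp_infinite_dimensional[OF p1 dom f])
      show "(\<lambda>z. 1 / (z - b)) holomorphic_on \<Omega>"
        using far b(1) by (intro holomorphic_intros) fastforce
      show "norm (1 / (z - b)) \<le> 1 / r" if "z \<in> \<Omega>" for z
        using far[OF that] b(1) by (simp add: norm_divide frac_le)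
      show "\<not> (\<lambda>z. 1 / (z - b)) constant_on \<Omega>"
      proof
        assume "(\<lambda>z. 1 / (z - b)) constant_on \<Omega>"
        then obtain v where v: "\<And>z. z \<in> \<Omega> \<Longrightarrow> 1 / (z - b) = v" by (auto simp: constant_on_def)
        have "\<Omega> \<subseteq> {b + 1 / v}"
        proof
          fix z assume z: "z \<in> \<Omega>"
          then have "z - b \<noteq> 0" using far[OF z] b(1) by auto
          then have "z - b = 1 / v" using v[OF z, symmetric] by simp
          then show "z \<in> {b + 1 / v}" by (simp add: algebra_simps)
        qed
        then have "finite \<Omega>" using finite_subset by blast
        then show False using finite_imp_not_open \<open>\<Omega> \<noteq> {}\<close> op by blast
      qed
    qed
  next
    case 2
    have cl: "closed (- \<Omega>)" using op by (simp add: closed_Compl)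
    have "\<exists>n::nat. - \<Omega> \<inter> cball 0 (real n) \<notin> null_sets lborel"
    proof (rule ccontr)
      assume "\<not> ?thesis"
      then have "(\<Union>n::nat. - \<Omega> \<inter> cball 0 (real n)) \<in> null_sets lborel"
        by (intro null_sets_UN) blast
      moreover have "(\<Union>n::nat. - \<Omega> \<inter> cball 0 (real n)) = - \<Omega>"
        using real_arch_simple by (auto simp: less_imp_le)
      ultimately show False using 2 by simp
    qed
    then obtain n :: nat where n: "- \<Omega> \<inter> cball 0 (real n) \<notin> null_sets lborel" by blast
    define K where "K = - \<Omega> \<inter> cball 0 (real n)"
    have K: "compact K" unfolding K_def using cl by (intro closed_Int_compact) auto
    have "emeasure lborel K \<noteq> 0" using n K by (auto simp: K_def null_sets_def intro: borel_compact)
    then have pos: "measure lborel K > 0"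
      using emeasure_compact_finite[OF K] by (simp add: measure_def enn2real_positive_iff zero_less_iff_neq_zero)
    have sub: "\<Omega> \<subseteq> - K" by (auto simp: K_def)
    have "- closure \<Omega> = {}" using 2(1) by (simp add: interior_complement)
    then have dense: "closure \<Omega> = UNIV" by blast
    obtain M where "\<And>z. norm (cauchy_transform K z) \<le> M" using cauchy_transform_bounded[OF K] by blast
    then show ?thesis
      using cauchy_transform_holomorphic[OF K] sub cauchy_transform_not_constant[OF K pos sub dense]
      by (intro bounded_nonconstant_imp_infinite_dimensional[OF p1 dom f, of "cauchy_transform K" M])
        (auto intro: holomorphic_on_subset)
  next
    case 3
    then show ?thesis by (rule null_complement_imp_infinite_dimensional[OF p op _ f])
  qed
qed

theorem theorem2p2:
  shows "(\<forall>p::real. 1 \<le> p \<and> p < 2 \<longrightarrow>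
            (\<forall>k::nat. 1 \<le> k \<longrightarrow> (\<exists>\<Omega>. complex_domain \<Omega> \<and> cfun.dim (Ap p \<Omega>) = k))) \<and>
         (\<forall>p::real. 2 \<le> p \<longrightarrow>
            (\<forall>\<Omega>. complex_domain \<Omega> \<longrightarrow>
               Ap p \<Omega> = {0} \<or>
               (infinite_dimensional (Ap p \<Omega>) \<and> complex_banach_space_on (Ap p \<Omega>) (Ap_norm p \<Omega>))))"
proof (intro conjI allI impI)
  fix p :: real and k :: nat
  assume "1 \<le> p \<and> p < 2"
  then show "\<exists>\<Omega>. complex_domain \<Omega> \<and> cfun.dim (Ap p \<Omega>) = k"
    using exists_domain_with_dim_Ap by blast
next
  fix p :: real and \<Omega>
  assume p: "2 \<le> p" and dom: "complex_domain \<Omega>"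
  have p1: "1 \<le> p" and op: "open \<Omega>" using p dom by (auto simp: complex_domain_def)
  show "Ap p \<Omega> = {0} \<or> (infinite_dimensional (Ap p \<Omega>) \<and> complex_banach_space_on (Ap p \<Omega>) (Ap_norm p \<Omega>))"
  proof (cases "Ap p \<Omega> = {0}")
    case False
    moreover have "0 \<in> Ap p \<Omega>" using Ap_subspace[OF p1 op] by (rule cfun.subspace_0)
    ultimately obtain f where "f \<in> Ap p \<Omega>" "f \<noteq> 0" by blast
    then show ?thesis using Ap_infinite_dimensional[OF p dom] Ap_banach[OF p1 op] by blast
  qed simp
qed

end
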